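(* Let $a<b$ and $0<\alpha<1$. Let $p,g_1,g_2:[a,b]\to\mathbb{R}$ be continuous, with $p(t)\ge 0$ on $[a,b]$ and $p(a)\neq 0$. Let $u_1,u_2\in H^1(a,b)\cap C[a,b]$ satisfy $$({}^{ABC}{}_{a}D^\alpha u_1)(t)+p(t)u_1(t)=g_1(t),\qquad ({}^{ABC}{}_{a}D^\alpha u_2)(t)+p(t)u_2(t)=g_2(t)$$ for all $t\in(a,b]$. If $g_1(t)\le g_2(t)$ on $[a,b]$, then $u_1(t)\le u_2(t)$ for all $t\in[a,b]$.
   Context: All functions are real-valued. $E_\alpha(z)=\sum_{k\ge 0} z^k/\Gamma(\alpha k+1)$ is the Mittag-Leffler function, and $B$ is a normalization function with $B(\alpha)>0$ and $B(0)=B(1)=1$. For $f\in H^1(a,b)$ and $\alpha\in(0,1)$, the left Caputo fractional derivative with Mittag-Leffler non-singular kernel is $$({}^{ABC}{}_{a}D^\alpha f)(t)=\frac{B(\alpha)}{1-\alpha}\int_a^t E_\alpha\!\left[-\frac{\alpha}{1-\alpha}(t-s)^\alpha\right] f'(s)\,ds,\qquad t\in[a,b].$$ *)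

theory Defs
  imports "HOL-Analysis.Analysis"
begin

definition mittag_leffler :: "real \<Rightarrow> real \<Rightarrow> real" where
  "mittag_leffler \<alpha> z = (\<Sum>k. z ^ k / Gamma (\<alpha> * real k + 1))"

definition normalization_function :: "(real \<Rightarrow> real) \<Rightarrow> bool" where
  "normalization_function B \<longleftrightarrow> (\<forall>\<alpha>\<in>{0..1}. B \<alpha> > 0) \<and> B 0 = 1 \<and> B 1 = 1"

text \<open>Test functions \<open>C\<^sub>c\<^sup>\<infinity>(a,b)\<close>, extended by zero to the whole line. The support is closed and
  contained in a bounded interval, hence automatically compact.\<close>

definition test_function :: "real \<Rightarrow> real \<Rightarrow> (real \<Rightarrow> real) \<Rightarrow> bool" where
  "test_function a b \<phi> \<longleftrightarrow>
     (\<forall>n x. (deriv ^^ n) \<phi> differentiable (at x)) \<and>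
     closure {x. \<phi> x \<noteq> 0} \<subseteq> {a<..<b}"

definition locally_integrable :: "real \<Rightarrow> real \<Rightarrow> (real \<Rightarrow> real) \<Rightarrow> bool" where
  "locally_integrable a b f \<longleftrightarrow>
     (\<forall>c d. a < c \<and> d < b \<longrightarrow> set_integrable lebesgue {c..d} f)"

definition has_weak_derivative ::
  "real \<Rightarrow> real \<Rightarrow> (real \<Rightarrow> real) \<Rightarrow> (real \<Rightarrow> real) \<Rightarrow> bool" where
  "has_weak_derivative a b f v \<longleftrightarrow>
     locally_integrable a b f \<and> locally_integrable a b v \<and>
     (\<forall>\<phi>. test_function a b \<phi> \<longrightarrow>
        (LINT x:{a<..<b}|lebesgue. f x * deriv \<phi> x) =
        - (LINT x:{a<..<b}|lebesgue. v x * \<phi> x))"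

definition L2 :: "real \<Rightarrow> real \<Rightarrow> (real \<Rightarrow> real) set" where
  "L2 a b = {f. f \<in> borel_measurable (lebesgue_on {a<..<b}) \<and>
                integrable (lebesgue_on {a<..<b}) (\<lambda>x. (f x)\<^sup>2)}"

definition H1 :: "real \<Rightarrow> real \<Rightarrow> (real \<Rightarrow> real) set" where
  "H1 a b = {f. f \<in> L2 a b \<and> (\<exists>v\<in>L2 a b. has_weak_derivative a b f v)}"

text \<open>The weak derivative is determined only almost everywhere on \<open>(a,b)\<close>; a representative is
  chosen here. It is used only under a Lebesgue integral over a subinterval of \<open>[a,b]\<close>, which
  does not depend on the choice.\<close>

definition weak_deriv :: "real \<Rightarrow> real \<Rightarrow> (real \<Rightarrow> real) \<Rightarrow> real \<Rightarrow> real" where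
  "weak_deriv a b f = (SOME v. v \<in> L2 a b \<and> has_weak_derivative a b f v)"

text \<open>The right endpoint \<open>b\<close> enters only through the interval on which \<open>f'\<close> is taken.\<close>

definition ABC_deriv ::
  "(real \<Rightarrow> real) \<Rightarrow> real \<Rightarrow> real \<Rightarrow> real \<Rightarrow> (real \<Rightarrow> real) \<Rightarrow> real \<Rightarrow> real" where
  "ABC_deriv B \<alpha> a b f t =
     B \<alpha> / (1 - \<alpha>) *
     (LINT s:{a..t}|lebesgue.
        mittag_leffler \<alpha> (- (\<alpha> / (1 - \<alpha>)) * (t - s) powr \<alpha>) * weak_deriv a b f s)"

end

(* Write w = u2 - u1, h = K * w' with K(t) = E_\<alpha>(-\<lambda> t^\<alpha>), \<lambda> = \<alpha>/(1-\<alpha>), so that the equations read h = c (g - p w)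
   with c > 0 and g = g2 - g1 \<ge> 0. Since K + \<lambda> I^\<alpha> K = 1 for the Riemann-Liouville integral I^\<alpha>,
   Fubini turns h = K * w' into the Volterra equation w - w(a) = h + \<lambda> I^\<alpha> h; this replaces any use of
   the positivity and monotonicity of K. Letting t tend to a gives h(a) = 0 and hence w(a) \<ge> 0.
   Now y = w - h = w(a) + \<lambda> I^\<alpha> h, and h \<ge> 0 wherever y < 0: if w \<le> 0, then h = c (g - p w) \<ge> 0,
   and otherwise h > w > 0. A comparison principle for I^\<alpha> yields y \<ge> 0, that is,
   w \<ge> c (g - p w), which excludes w < 0. *)

theory Submission
  imports Defs "HOL-Real_Asymp.Real_Asymp"
begin

section \<open>Smooth functions of compact support\<close>

text \<open>The function w is only in H^1: its derivative is some square-integrable representative,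
  so no pointwise argument at a minimum of w is available, and even the formula w(t) - w(a) =
  integral of w' has to be recovered from test functions. This is the purpose of the bump functions
  and mollifiers. The gain of the Volterra form is that w' disappears, and only continuous data
  enter the comparison. The comparison is not a plain first-exit argument, because the kernel (t -
  r)^(\<alpha> - 1) weighs the whole past anew for each t; a bound is therefore kept for all partial
  integrals over [a,s], s \<le> t, at once. Each solution gets its own Volterra equation, and the
  difference is taken only afterwards, since the choice made in \<open>weak_deriv\<close> is linear
  in the function only almost everywhere.\<close>

definition smooth :: "(real \<Rightarrow> real) \<Rightarrow> bool" where
  "smooth f \<longleftrightarrow> (\<forall>n x. (deriv ^^ n) f differentiable (at x))"

text \<open>The smooth functions, that is, those in the first clause of
  \<open>test_function\<close>, form the greatest class stable under differentiation. A closure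
  property thus needs only a class containing the function and stable under one derivative, never a
  formula for the n-th derivative.\<close>

lemma smooth_coinduct:
  assumes "f \<in> C"
    and "\<And>g. g \<in> C \<Longrightarrow> \<exists>g'\<in>C. \<forall>x. (g has_real_derivative g' x) (at x)"
  shows "smooth f"
proof -
  have "(deriv ^^ n) f \<in> C" for n
  proof (induction n)
    case (Suc n)
    obtain g' where g': "g' \<in> C" "\<forall>x. ((deriv ^^ n) f has_real_derivative g' x) (at x)"
      using assms(2)[OF Suc] by blast
    then have "deriv ((deriv ^^ n) f) = g'"
      by (auto intro: DERIV_imp_deriv)
    then show ?case
      using g'(1) by simp
  qed (use assms(1) in simp)
  then show ?thesis
    unfolding smooth_def by (metis assms(2) real_differentiable_def)
qed

lemma smooth_DERIV:
  assumes "smooth f" shows "(f has_real_derivative deriv f x) (at x)"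
proof -
  have "f differentiable at x"
    using assms unfolding smooth_def by (metis funpow_0)
  then show ?thesis
    by (simp add: DERIV_deriv_iff_real_differentiable)
qed

lemma smooth_deriv: "smooth f \<Longrightarrow> smooth (deriv f)"
  unfolding smooth_def by (metis comp_apply funpow_Suc_right)

lemma smooth_antiderivative:
  assumes "\<And>x. (f has_real_derivative f' x) (at x)" and "smooth f'"
  shows "smooth f"
proof (rule smooth_coinduct)
  show "f \<in> insert f (Collect smooth)" by simp
next
  fix g assume "g \<in> insert f (Collect smooth)"
  then consider "g = f" | "smooth g" by blast
  then show "\<exists>g'\<in>insert f (Collect smooth). \<forall>x. (g has_real_derivative g' x) (at x)"
    by cases (use assms smooth_DERIV smooth_deriv in blast)+
qed

lemma smooth_diff:
  assumes "smooth f" "smooth g" shows "smooth (\<lambda>x. f x - g x)"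
proof (rule smooth_coinduct)
  show "(\<lambda>x. f x - g x) \<in> {\<lambda>x. f x - g x |f g. smooth f \<and> smooth g}"
    using assms by auto
next
  fix k assume "k \<in> {\<lambda>x. f x - g x |f g. smooth f \<and> smooth g}"
  then obtain f g where k: "k = (\<lambda>x. f x - g x)" "smooth f" "smooth g" by blast
  then have "(k has_real_derivative deriv f x - deriv g x) (at x)" for x
    by (auto intro!: DERIV_diff smooth_DERIV)
  then show "\<exists>k'\<in>{\<lambda>x. f x - g x |f g. smooth f \<and> smooth g}. \<forall>x. (k has_real_derivative k' x) (at x)"
    using k smooth_deriv by (intro bexI[where x = "\<lambda>x. deriv f x - deriv g x"]) auto
qed

lemma smooth_affine:
  assumes "smooth f" shows "smooth (\<lambda>x. c * f (m * x + d))"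
proof (rule smooth_coinduct)
  show "(\<lambda>x. c * f (m * x + d)) \<in> {\<lambda>x. c * f (m * x + d) |c f. smooth f}"
    using assms by auto
next
  fix k assume "k \<in> {\<lambda>x. c * f (m * x + d) |c f. smooth f}"
  then obtain c f where k: "k = (\<lambda>x. c * f (m * x + d))" "smooth f" by blast
  have "(k has_real_derivative (c * m) * deriv f (m * x + d)) (at x)" for x
  proof -
    have "((\<lambda>x. m * x + d) has_real_derivative m) (at x)"
      by (auto intro!: derivative_eq_intros)
    from DERIV_cmult[OF DERIV_chain2[OF smooth_DERIV[OF k(2)] this], of c] show ?thesis
      by (simp add: k(1) mult_ac)
  qed
  then show "\<exists>k'\<in>{\<lambda>x. c * f (m * x + d) |c f. smooth f}. \<forall>x. (k has_real_derivative k' x) (at x)"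
    using k smooth_deriv by (intro bexI[where x = "\<lambda>x. (c * m) * deriv f (m * x + d)"]) auto
qed

text \<open>Products alone are not stable under differentiation, since the product rule yields a
  sum; finite sums of products are, and serve as the class for
  \<open>smooth_coinduct\<close>.\<close>

inductive_set mult_span :: "(real \<Rightarrow> real) set" where
  mult: "smooth f \<Longrightarrow> smooth g \<Longrightarrow> (\<lambda>x. f x * g x) \<in> mult_span"
| add: "f \<in> mult_span \<Longrightarrow> g \<in> mult_span \<Longrightarrow> (\<lambda>x. f x + g x) \<in> mult_span"

lemma smooth_mult:
  assumes "smooth f" "smooth g" shows "smooth (\<lambda>x. f x * g x)"
proof (rule smooth_coinduct)
  show "(\<lambda>x. f x * g x) \<in> mult_span"
    using assms by (rule mult_span.mult)
next
  fix k assume "k \<in> mult_span"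
  then show "\<exists>k'\<in>mult_span. \<forall>x. (k has_real_derivative k' x) (at x)"
  proof induction
    case (mult f g)
    have "(\<lambda>x. deriv f x * g x + deriv g x * f x) \<in> mult_span"
      by (intro mult_span.intros smooth_deriv mult)
    then show ?case
      using mult by (intro bexI[where x = "\<lambda>x. deriv f x * g x + deriv g x * f x"])
        (auto intro!: DERIV_mult smooth_DERIV)
  next
    case (add f g)
    then obtain f' g' where "f' \<in> mult_span" "\<forall>x. (f has_real_derivative f' x) (at x)"
      "g' \<in> mult_span" "\<forall>x. (g has_real_derivative g' x) (at x)" by blast
    then show ?case
      by (intro bexI[where x = "\<lambda>x. f' x + g' x"]) (auto intro!: DERIV_add mult_span.add)
  qed
qed

text \<open>The classical function exp(-1/x), extended by 0, together with all polynomial factors in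
  1/x that arise when it is differentiated.\<close>

definition flat :: "real poly \<Rightarrow> real \<Rightarrow> real" where
  "flat P x = (if 0 < x then poly P (1 / x) * exp (- (1 / x)) else 0)"

lemma poly_exp_tendsto_0: "((\<lambda>z::real. poly P z * exp (- z)) \<longlongrightarrow> 0) at_top"
proof -
  have "((\<lambda>z. \<Sum>i\<le>degree P. coeff P i * (z ^ i / exp z)) \<longlongrightarrow> (\<Sum>i\<le>degree P. coeff P i * 0)) at_top"
    by (intro tendsto_sum tendsto_mult tendsto_const tendsto_power_div_exp_0)
  then show ?thesis
    by (simp add: poly_altdef sum_distrib_right exp_minus divide_inverse mult.assoc)
qed

text \<open>With z = 1/x, d/dx is -z^2 d/dz, which sends P(z) exp(-z) to z^2 (P - P')(z) exp(-z);
  the polynomial \<open>[:0, 0, 1:]\<close> is z^2. At 0 the right difference quotient is z P(z)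
  exp(-z), which tends to 0 as z grows.\<close>

lemma flat_has_derivative:
  "(flat P has_real_derivative flat ([:0, 0, 1:] * (P - pderiv P)) x) (at x)"
proof -
  consider "x < 0" | "x = 0" | "x > 0" by linarith
  then show ?thesis
  proof cases
    case 1
    have "\<forall>\<^sub>F y in nhds x. flat P y = 0"
      by (rule eventually_mono[OF eventually_nhds_in_open[of "{..<0}" x]]) (use 1 in \<open>auto simp: flat_def\<close>)
    then show ?thesis
      using 1 by (subst DERIV_cong_ev[OF refl _ refl]) (auto simp: flat_def)
  next
    case 2
    have "((\<lambda>y. flat P y / y) \<longlongrightarrow> 0) (at_left 0)"
      by (rule tendsto_eventually) (auto simp: eventually_at_filter flat_def)
    moreover have "((\<lambda>y. flat P y / y) \<longlongrightarrow> 0) (at_right 0)"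
    proof -
      have "((\<lambda>y. poly ([:0, 1:] * P) (inverse y) * exp (- (inverse y))) \<longlongrightarrow> 0) (at_right (0::real))"
        by (rule filterlim_compose[OF poly_exp_tendsto_0 filterlim_inverse_at_top_right])
      moreover have "\<forall>\<^sub>F y in at_right 0. poly ([:0, 1:] * P) (inverse y) * exp (- (inverse y)) = flat P y / y"
        using eventually_at_right_less[of 0] by eventually_elim (auto simp: flat_def field_simps)
      ultimately show ?thesis
        by (rule Lim_transform_eventually)
    qed
    ultimately have "((\<lambda>y. flat P y / y) \<longlongrightarrow> 0) (at 0)"
      by (simp add: filterlim_at_split)
    then show ?thesis
      using 2 by (simp add: has_field_derivative_iff flat_def)
  next
    case 3
    have "\<forall>\<^sub>F y in nhds x. flat P y = poly P (1 / y) * exp (- (1 / y))"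
      by (rule eventually_mono[OF eventually_nhds_in_open[of "{0<..}" x]]) (use 3 in \<open>auto simp: flat_def\<close>)
    moreover have "((\<lambda>y. poly P (1 / y) * exp (- (1 / y))) has_real_derivative
        flat ([:0, 0, 1:] * (P - pderiv P)) x) (at x)"
    proof -
      have inv: "((\<lambda>y. 1 / y) has_real_derivative - (1 / x\<^sup>2)) (at x)"
        using 3 by (auto intro!: derivative_eq_intros simp: power2_eq_square)
      have "((\<lambda>y. poly P (1 / y)) has_real_derivative poly (pderiv P) (1 / x) * - (1 / x\<^sup>2)) (at x)"
        by (rule DERIV_chain2[OF poly_DERIV inv])
      moreover have "((\<lambda>y. exp (- (1 / y))) has_real_derivative exp (- (1 / x)) * - (- (1 / x\<^sup>2))) (at x)"
        by (rule DERIV_chain2[OF DERIV_exp DERIV_minus[OF inv]])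
      ultimately show ?thesis
        by (rule DERIV_mult[THEN DERIV_cong]) (use 3 in \<open>simp add: flat_def power2_eq_square algebra_simps\<close>)
    qed
    ultimately show ?thesis
      by (subst DERIV_cong_ev[OF refl _ refl])
  qed
qed

lemma smooth_flat: "smooth (flat P)"
  by (rule smooth_coinduct[of _ "range flat"]) (blast intro: flat_has_derivative)+

lemma smooth_bump:
  obtains \<eta> :: "real \<Rightarrow> real" where "smooth \<eta>" "\<And>x. \<eta> x \<ge> 0" "\<And>x. x \<notin> {0<..<1} \<Longrightarrow> \<eta> x = 0"
    "(\<eta> has_integral 1) {0..1}"
proof -
  \<comment> \<open>On (0,1) this is exp(-1/x) exp(-1/(1-x)), and one of the factors vanishes
    elsewhere. The factors 1 and -1 are written out to match \<open>smooth_affine\<close>.\<close>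
  define \<zeta> where "\<zeta> x = flat 1 x * (1 * flat 1 ((-1) * x + 1))" for x
  have sm: "smooth \<zeta>"
    unfolding \<zeta>_def by (rule smooth_mult[OF smooth_flat smooth_affine[OF smooth_flat]])
  have pos: "\<zeta> x > 0" if "x \<in> {0<..<1}" for x
    using that by (auto simp: \<zeta>_def flat_def)
  have zero: "\<zeta> x = 0" if "x \<notin> {0<..<1}" for x
    using that by (auto simp: \<zeta>_def flat_def)
  have cont: "continuous_on {0..1} \<zeta>"
    using smooth_DERIV[OF sm] by (meson DERIV_isCont continuous_at_imp_continuous_on)
  have nn: "\<zeta> x \<ge> 0" for x
    using pos zero by (metis less_eq_real_def)
  define Z where "Z = integral {0..1} \<zeta>"
  have "Z \<noteq> 0"
  proof
    assume "Z = 0"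
    then have "(\<zeta> has_integral 0) {0..1}"
      using integrable_continuous_real[OF cont] by (metis Z_def integrable_integral)
    then have "\<zeta> (1/2) = 0"
      using has_integral_0_cbox_imp_0[of 0 1 \<zeta> "1/2"] cont nn by simp
    then show False using pos[of "1/2"] by simp
  qed
  moreover have "Z \<ge> 0"
    unfolding Z_def using nn by (intro integral_nonneg integrable_continuous_real cont) auto
  ultimately have Z: "Z > 0" by simp
  have "(\<zeta> has_integral Z) {0..1}"
    unfolding Z_def by (intro integrable_integral integrable_continuous_real cont)
  then have "((\<lambda>x. (1/Z) * \<zeta> (1 * x + 0)) has_integral 1) {0..1}"
    using has_integral_mult_right[of \<zeta> Z "{0..1}" "1/Z"] Z by simp
  then show ?thesis
    by (rule that[OF smooth_affine[OF sm], rotated 2]) (use Z nn zero in auto)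
qed

section \<open>Weak derivatives and the fundamental theorem of calculus\<close>

text \<open>The interval has finite measure, and |v| \<le> 1 + v^2.\<close>

lemma L2_integrable:
  assumes "v \<in> L2 a b"
  shows "integrable lebesgue (\<lambda>x. indicator {a<..<b} x * v x)"
proof -
  have v: "v \<in> borel_measurable (lebesgue_on {a<..<b})" "integrable (lebesgue_on {a<..<b}) (\<lambda>x. (v x)\<^sup>2)"
    using assms by (auto simp: L2_def)
  have "integrable (lebesgue_on {a<..<b}) (\<lambda>x. 1 :: real)"
    using emeasure_lborel_box_finite[of a b]
    by (simp add: integrable_restrict_space integrable_completion integrable_indicator_iff)
  then have "integrable (lebesgue_on {a<..<b}) (\<lambda>x. 1 + (v x)\<^sup>2)"
    using v(2) by (rule Bochner_Integration.integrable_add)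
  moreover have "\<bar>v x\<bar> \<le> \<bar>1 + (v x)\<^sup>2\<bar>" for x
  proof -
    have "0 \<le> (\<bar>v x\<bar> - 1/2)\<^sup>2" by simp
    then show ?thesis by (simp add: power2_eq_square algebra_simps)
  qed
  ultimately have "integrable (lebesgue_on {a<..<b}) v"
    using v(1) by (auto intro: Bochner_Integration.integrable_bound)
  then show ?thesis
    by (simp add: integrable_restrict_space set_integrable_def)
qed

text \<open>A weak derivative is only Lebesgue measurable; Fubini and affine substitutions on
  \<open>lborel\<close> need a Borel representative.\<close>

lemma L2_borel_version:
  assumes "v \<in> L2 a b"
  obtains V where "integrable lborel V" "AE x in lborel. indicator {a<..<b} x * v x = V x"
proof -
  note int = L2_integrable[OF assms]
  then obtain V where V: "V \<in> borel_measurable lborel" "AE x in lborel. indicator {a<..<b} x * v x = V x"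
    using completion_ex_borel_measurable_real[OF borel_measurable_integrable[OF int]] by blast
  have "integrable lebesgue V"
    using integrable_cong_AE_imp[OF int measurable_completion[OF V(1)]] AE_completion[OF V(2)]
    by blast
  then have "integrable lborel V"
    using V(1) integrable_completion by blast
  with V(2) that show ?thesis by blast
qed

text \<open>\<open>V\<close> represents \<open>v\<close> only on the open interval. The set
  \<open>A\<close> may contain a or b, which are null, so integrals over {a..t} are covered
  too.\<close>

lemma set_integral_borel_version:
  fixes k :: "real \<Rightarrow> real"
  assumes V: "integrable lborel V" "AE x in lborel. indicator {a<..<b} x * v x = V x"
    and v: "v \<in> L2 a b"
    and k: "k \<in> borel_measurable borel"
    and A: "A \<in> sets borel" "A \<subseteq> {a..b}"
  shows "(LINT x:A|lebesgue. k x * v x) = (LINT x:A|lborel. k x * V x)"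
proof -
  have ae: "AE x in lebesgue. indicator A x * (k x * v x) = indicator A x * (k x * V x)"
  proof (rule AE_completion)
    show "AE x in lborel. indicator A x * (k x * v x) = indicator A x * (k x * V x)"
      using V(2) AE_lborel_singleton[of a] AE_lborel_singleton[of b]
    proof eventually_elim
      case (elim x)
      show ?case
      proof (cases "x \<in> A")
        case True
        then have "x \<in> {a<..<b}" using A(2) elim(2,3) by (auto simp: less_le)
        then show ?thesis using elim(1) by simp
      qed simp
    qed
  qed
  have V_meas: "V \<in> borel_measurable borel"
    using V(1) by auto
  have m2: "(\<lambda>x. indicator A x * (k x * V x)) \<in> borel_measurable lborel"
    using V_meas k A(1) by simp
  then have "(\<lambda>x. indicator A x * (k x * V x)) \<in> borel_measurable lebesgue"
    by (rule measurable_completion)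
  moreover from this have "(\<lambda>x. indicator A x * (k x * v x)) \<in> borel_measurable lebesgue"
    by (rule borel_measurable_AE[OF _ AE_symmetric[OF ae]])
  ultimately have "(LINT x|lebesgue. indicator A x * (k x * v x)) = (LINT x|lebesgue. indicator A x * (k x * V x))"
    by (intro integral_cong_AE ae)
  also have "\<dots> = (LINT x|lborel. indicator A x * (k x * V x))"
    by (rule integral_completion[OF m2])
  finally show ?thesis
    by (simp add: set_lebesgue_integral_def)
qed

lemma smooth_isCont: "smooth f \<Longrightarrow> isCont f x"
  using smooth_DERIV DERIV_isCont by blast

text \<open>The antiderivative of a normalized bump is a smooth step from 0 to 1. Differences of
  rescaled copies give test functions that approximate the indicator of an interval.\<close>

lemma smooth_step:
  obtains \<psi> \<eta> :: "real \<Rightarrow> real" where "smooth \<psi>" "\<And>x. (\<psi> has_real_derivative \<eta> x) (at x)"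
    "\<And>x. x \<le> 0 \<Longrightarrow> \<psi> x = 0" "\<And>x. x \<ge> 1 \<Longrightarrow> \<psi> x = 1" "\<And>x. \<psi> x \<in> {0..1}"
    "\<And>x. \<eta> x \<ge> 0" "\<And>x. x \<notin> {0<..<1} \<Longrightarrow> \<eta> x = 0"
    "integrable lborel \<eta>" "(LINT x|lborel. \<eta> x) = 1"
proof -
  obtain \<eta> :: "real \<Rightarrow> real" where \<eta>: "smooth \<eta>" "\<And>x. \<eta> x \<ge> 0"
    "\<And>x. x \<notin> {0<..<1} \<Longrightarrow> \<eta> x = 0" "(\<eta> has_integral 1) {0..1}"
    using smooth_bump by blast
  have cont: "continuous_on A \<eta>" for A
    using smooth_isCont[OF \<eta>(1)] continuous_at_imp_continuous_on by blast
  have intg: "\<eta> integrable_on {c..d}" for c d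
    by (intro integrable_continuous_real cont)
  \<comment> \<open>The base point -1 lies to the left of the support of \<eta>, so every x \<ge> 0
    is interior to {-1..x+1} and the derivative at 0 is two-sided.\<close>
  define \<psi> where "\<psi> x = integral {-1..x} \<eta>" for x
  have \<psi>0: "\<psi> x = 0" if "x \<le> 0" for x
  proof -
    have "integral {-1..x} \<eta> = integral {-1..x} (\<lambda>x. 0)"
      using that by (intro integral_cong \<eta>) auto
    then show ?thesis by (simp add: \<psi>_def)
  qed
  have \<psi>1: "\<psi> x = 1" if "x \<ge> 1" for x
  proof -
    have "integral {1..x} \<eta> = integral {1..x} (\<lambda>x. 0)"
      by (intro integral_cong \<eta>) auto
    moreover have "integral {-1..x} \<eta> = integral {-1..0} \<eta> + (integral {0..1} \<eta> + integral {1..x} \<eta>)"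
      using that by (simp add: Henstock_Kurzweil_Integration.integral_combine intg)
    ultimately show ?thesis
      using \<psi>0[of 0] integral_unique[OF \<eta>(4)] by (simp add: \<psi>_def)
  qed
  have mono: "\<psi> x \<le> \<psi> y" if "x \<le> y" for x y
    unfolding \<psi>_def using that by (intro integral_subset_le intg) (auto simp: \<eta>)
  have \<psi>01: "\<psi> x \<in> {0..1}" for x
    using mono[of x 1] mono[of 0 x] mono[of x 0] mono[of 1 x] \<psi>0[of 0] \<psi>0[of x] \<psi>1[of 1] \<psi>1[of x]
    by (cases "x \<le> 0"; cases "x \<ge> 1") auto
  have deriv: "(\<psi> has_real_derivative \<eta> x) (at x)" for x
  proof (cases "x < 0")
    case True
    have "\<forall>\<^sub>F y in nhds x. \<psi> y = 0"
      by (rule eventually_mono[OF eventually_nhds_in_open[of "{..<0}" x]]) (use True \<psi>0 in auto)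
    then show ?thesis
      using True \<eta>(3)[of x] by (subst DERIV_cong_ev[OF refl _ refl]) auto
  next
    case False
    have "(\<psi> has_real_derivative \<eta> x) (at x within {-1..x+1})"
      unfolding \<psi>_def using False by (intro integral_has_real_derivative cont) auto
    then show ?thesis
      using False at_within_interior[of x "{-1..x+1}"] by simp
  qed
  have "set_integrable lborel {0..1} \<eta>"
    by (rule borel_integrable_atLeastAtMost'[OF cont])
  moreover have ind: "indicat_real {0..1} x * \<eta> x = \<eta> x" for x
    using \<eta>(3)[of x] by (cases "x \<in> {0<..<1}") auto
  ultimately have int: "integrable lborel \<eta>"
    by (simp add: set_integrable_def)
  have "(LINT x:{0..1}|lborel. \<eta> x) = 1"
    using set_borel_integral_eq_integral(2)[OF \<open>set_integrable lborel {0..1} \<eta>\<close>] integral_unique[OF \<eta>(4)] by simp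
  then have "(LINT x|lborel. \<eta> x) = 1"
    by (simp add: set_lebesgue_integral_def ind)
  then show ?thesis
    by (intro that[OF smooth_antiderivative[OF deriv \<eta>(1)] deriv] \<psi>0 \<psi>1 \<psi>01 \<eta> int)
qed

text \<open>The substitution x = s + \<epsilon> y moves the scaling into f, and dominated
  convergence applies with the bound M |\<eta>|.\<close>

lemma mollifier_tendsto:
  fixes f \<eta> :: "real \<Rightarrow> real"
  assumes f: "\<And>x. isCont f x" "\<And>x. \<bar>f x\<bar> \<le> M"
    and \<eta>: "integrable lborel \<eta>" "(LINT x|lborel. \<eta> x) = 1"
    and \<epsilon>: "\<And>n. \<epsilon> n > 0" "\<epsilon> \<longlonglongrightarrow> 0"
  shows "(\<lambda>n. LINT x|lborel. f x * (\<eta> ((x - s) / \<epsilon> n) / \<epsilon> n)) \<longlonglongrightarrow> f s"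
    and "integrable lborel (\<lambda>x. f x * (\<eta> ((x - s) / \<epsilon> n) / \<epsilon> n))"
proof -
  have fm: "f \<in> borel_measurable borel"
    using f(1) by (intro borel_measurable_continuous_onI continuous_at_imp_continuous_on) auto
  have \<eta>m: "\<eta> \<in> borel_measurable borel"
    using \<eta>(1) by auto
  have eq: "(LINT x|lborel. f x * (\<eta> ((x - s) / \<epsilon> n) / \<epsilon> n)) = (LINT y|lborel. f (s + \<epsilon> n * y) * \<eta> y)" for n
    using \<epsilon>(1)[of n] by (subst lborel_integral_real_affine[of "\<epsilon> n" _ s]) auto
  have "(\<lambda>n. LINT y|lborel. f (s + \<epsilon> n * y) * \<eta> y) \<longlonglongrightarrow> (LINT y|lborel. f s * \<eta> y)"
  proof (rule integral_dominated_convergence[where w = "\<lambda>y. M * \<bar>\<eta> y\<bar>"])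
    have "(\<lambda>n. f (s + \<epsilon> n * y)) \<longlonglongrightarrow> f s" for y
      by (rule isCont_tendsto_compose[OF f(1)]) (use \<epsilon>(2) in \<open>auto intro!: tendsto_eq_intros\<close>)
    then show "AE y in lborel. (\<lambda>n. f (s + \<epsilon> n * y) * \<eta> y) \<longlonglongrightarrow> f s * \<eta> y"
      by (auto intro!: tendsto_mult)
    show "AE y in lborel. norm (f (s + \<epsilon> n * y) * \<eta> y) \<le> M * \<bar>\<eta> y\<bar>" for n
      by (auto simp: abs_mult intro!: mult_right_mono f(2))
  qed (use fm \<eta>m \<eta>(1) in auto)
  then show "(\<lambda>n. LINT x|lborel. f x * (\<eta> ((x - s) / \<epsilon> n) / \<epsilon> n)) \<longlonglongrightarrow> f s"
    unfolding eq by (simp add: \<eta>(2))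
  have "integrable lborel (\<lambda>y. \<eta> (- s / \<epsilon> n + (1 / \<epsilon> n) * y))"
    using \<eta>(1) \<epsilon>(1)[of n] by (intro lborel_integrable_real_affine) auto
  then have "integrable lborel (\<lambda>x. M * \<bar>\<eta> ((x - s) / \<epsilon> n) / \<epsilon> n\<bar>)"
    using \<epsilon>(1)[of n] by (simp add: diff_divide_distrib)
  then show "integrable lborel (\<lambda>x. f x * (\<eta> ((x - s) / \<epsilon> n) / \<epsilon> n))"
    by (rule Bochner_Integration.integrable_bound)
      (use fm \<eta>m in \<open>auto simp: abs_mult intro!: divide_right_mono mult_right_mono order_trans[OF f(2) abs_ge_self]\<close>)
qed

text \<open>The weak derivative is tested with a smooth plateau that rises just after s and falls
  just after t. Its derivative is a difference of two mollifiers, which yields u s - u t in the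
  limit, while the plateau itself tends to the indicator of (s,t].\<close>

lemma weak_derivative_integral_open:
  assumes st: "a < s" "s < t" "t < b"
    and u: "continuous_on {a..b} u"
    and weak: "has_weak_derivative a b u v" "v \<in> L2 a b"
    and V: "integrable lborel V" "AE x in lborel. indicator {a<..<b} x * v x = V x"
  shows "u t - u s = (LINT x:{s..t}|lborel. V x)"
proof -
  obtain \<psi> \<eta> :: "real \<Rightarrow> real" where \<psi>: "smooth \<psi>" "\<And>x. (\<psi> has_real_derivative \<eta> x) (at x)"
      "\<And>x. x \<le> 0 \<Longrightarrow> \<psi> x = 0" "\<And>x. x \<ge> 1 \<Longrightarrow> \<psi> x = 1" "\<And>x. \<psi> x \<in> {0..1}"
    and \<eta>: "\<And>x. \<eta> x \<ge> 0" "\<And>x. x \<notin> {0<..<1} \<Longrightarrow> \<eta> x = 0"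
      "integrable lborel \<eta>" "(LINT x|lborel. \<eta> x) = 1"
    by (rule smooth_step) blast
  \<comment> \<open>Clamping the argument extends u to a bounded continuous function on the whole
    line, as \<open>mollifier_tendsto\<close> requires.\<close>
  define w where "w x = u (max a (min b x))" for x
  have w_eq: "w x = u x" if "x \<in> {a..b}" for x
    using that by (simp add: w_def)
  have "continuous_on UNIV w"
    unfolding w_def using st by (intro continuous_on_compose2[OF u] continuous_intros) auto
  then have w_cont: "isCont w x" for x
    by (simp add: continuous_on_eq_continuous_at)
  obtain M where M: "\<forall>x\<in>{a..b}. \<bar>u x\<bar> \<le> M"
    using compact_imp_bounded[OF compact_continuous_image[OF u compact_Icc]]
    by (auto simp: bounded_iff)
  have w_bound: "\<bar>w x\<bar> \<le> M" for x
    unfolding w_def using st by (intro M[rule_format]) auto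
  \<comment> \<open>Division by n + 2 keeps \<open>\<epsilon> n\<close> at most (b - t)/2, so that
    the support in {s..t + \<epsilon> n} stays inside (a,b) for every n.\<close>
  define \<epsilon> where "\<epsilon> n = (b - t) / real (n + 2)" for n
  have \<epsilon>: "\<epsilon> n > 0" "\<epsilon> n < b - t" for n
    using st divide_strict_left_mono[of 1 "real (n + 2)" "b - t"] by (auto simp: \<epsilon>_def)
  have \<epsilon>_lim: "\<epsilon> \<longlonglongrightarrow> 0"
    unfolding \<epsilon>_def by real_asymp
  define \<phi> where "\<phi> n x = \<psi> ((x - s) / \<epsilon> n) - \<psi> ((x - t) / \<epsilon> n)" for n x
  define \<phi>' where "\<phi>' n x = \<eta> ((x - s) / \<epsilon> n) / \<epsilon> n - \<eta> ((x - t) / \<epsilon> n) / \<epsilon> n" for n x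
  have outside: "\<phi> n x = 0" if "x \<notin> {s..t + \<epsilon> n}" for n x
  proof (cases "x < s")
    case True
    then have "(x - s) / \<epsilon> n \<le> 0" "(x - t) / \<epsilon> n \<le> 0"
      using \<epsilon>(1)[of n] st by (auto simp: field_simps)
    then show ?thesis by (simp add: \<phi>_def \<psi>)
  next
    case False
    with that have "(x - s) / \<epsilon> n \<ge> 1" "(x - t) / \<epsilon> n \<ge> 1"
      using \<epsilon>(1)[of n] st by (auto simp: field_simps)
    then show ?thesis by (simp add: \<phi>_def \<psi>)
  qed
  have test: "test_function a b (\<phi> n)" for n
  proof -
    have "closure {x. \<phi> n x \<noteq> 0} \<subseteq> {s..t + \<epsilon> n}"
      by (rule closure_minimal) (use outside in blast, simp)
    also have "\<dots> \<subseteq> {a<..<b}"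
      using st \<epsilon>[of n] by auto
    finally have "closure {x. \<phi> n x \<noteq> 0} \<subseteq> {a<..<b}" .
    moreover have "smooth (\<phi> n)"
      using smooth_diff[OF smooth_affine[OF \<psi>(1), of 1 "1 / \<epsilon> n" "- s / \<epsilon> n"]
          smooth_affine[OF \<psi>(1), of 1 "1 / \<epsilon> n" "- t / \<epsilon> n"]]
      by (simp add: \<phi>_def[abs_def] diff_divide_distrib)
    ultimately show ?thesis
      by (simp add: test_function_def smooth_def)
  qed
  have deriv_\<phi>: "deriv (\<phi> n) = \<phi>' n" for n
  proof
    have "((\<lambda>x. \<psi> ((x - c) / \<epsilon> n)) has_real_derivative \<eta> ((x - c) / \<epsilon> n) * (1 / \<epsilon> n)) (at x)" for c x
      using \<epsilon>(1)[of n] by (intro DERIV_chain2[OF \<psi>(2)]) (auto intro!: derivative_eq_intros)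
    then show "deriv (\<phi> n) x = \<phi>' n x" for x
      unfolding \<phi>_def[abs_def] \<phi>'_def
      by (intro DERIV_imp_deriv DERIV_diff) simp_all
  qed
  have "(\<lambda>n. LINT x:{a<..<b}|lebesgue. u x * deriv (\<phi> n) x) \<longlonglongrightarrow> u s - u t"
  proof -
    note moll = mollifier_tendsto[OF w_cont w_bound \<eta>(3,4) \<epsilon>(1) \<epsilon>_lim]
    have [measurable]: "w \<in> borel_measurable borel" "\<eta> \<in> borel_measurable borel"
      using w_cont \<eta>(3) by (auto intro!: borel_measurable_continuous_onI continuous_at_imp_continuous_on)
    have "(LINT x:{a<..<b}|lebesgue. u x * deriv (\<phi> n) x)
        = (LINT x|lborel. w x * (\<eta> ((x - s) / \<epsilon> n) / \<epsilon> n)) - (LINT x|lborel. w x * (\<eta> ((x - t) / \<epsilon> n) / \<epsilon> n))" for n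
    proof -
      have "\<phi>' n x = 0" if "x \<notin> {a<..<b}" for x
      proof -
        have "(x - s) / \<epsilon> n \<notin> {0<..<1}" "(x - t) / \<epsilon> n \<notin> {0<..<1}"
          using that st \<epsilon>[of n] by (auto simp: field_simps)
        then show ?thesis by (simp add: \<phi>'_def \<eta>(2))
      qed
      then have "indicator {a<..<b} x *\<^sub>R (u x * deriv (\<phi> n) x) = w x * \<phi>' n x" for x
        by (cases "x \<in> {a<..<b}") (auto simp: deriv_\<phi> w_eq)
      then have "(LINT x:{a<..<b}|lebesgue. u x * deriv (\<phi> n) x) = (LINT x|lebesgue. w x * \<phi>' n x)"
        by (simp add: set_lebesgue_integral_def)
      also have "\<dots> = (LINT x|lborel. w x * \<phi>' n x)"
        by (rule integral_completion) (simp add: \<phi>'_def[abs_def])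
      also have "\<dots> = (LINT x|lborel. w x * (\<eta> ((x - s) / \<epsilon> n) / \<epsilon> n)) - (LINT x|lborel. w x * (\<eta> ((x - t) / \<epsilon> n) / \<epsilon> n))"
        unfolding \<phi>'_def right_diff_distrib by (intro Bochner_Integration.integral_diff moll(2))
      finally show ?thesis .
    qed
    then show ?thesis
      using tendsto_diff[OF moll(1)[of s] moll(1)[of t]] st by (simp add: w_eq)
  qed
  moreover have "(\<lambda>n. - (LINT x:{a<..<b}|lebesgue. v x * \<phi> n x)) \<longlonglongrightarrow> - (LINT x:{s..t}|lborel. V x)"
  proof -
    have \<psi>_meas [measurable]: "\<psi> \<in> borel_measurable borel"
      using smooth_isCont[OF \<psi>(1)] by (auto intro!: borel_measurable_continuous_onI continuous_at_imp_continuous_on)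
    have \<phi>_meas [measurable]: "\<phi> n \<in> borel_measurable borel" for n
      unfolding \<phi>_def by simp
    have \<phi>_bound: "\<bar>\<phi> n x\<bar> \<le> 1" for n x
      using \<psi>(5)[of "(x - s) / \<epsilon> n"] \<psi>(5)[of "(x - t) / \<epsilon> n"] unfolding \<phi>_def by (auto simp: abs_le_iff)
    have [measurable]: "V \<in> borel_measurable borel" using V(1) by auto
    have "(LINT x:{a<..<b}|lebesgue. v x * \<phi> n x) = (LINT x|lborel. indicator {a<..<b} x * (\<phi> n x * V x))" for n
      using set_integral_borel_version[OF V weak(2) \<phi>_meas, of "{a<..<b}" n]
      by (simp add: mult.commute set_lebesgue_integral_def greaterThanLessThan_subseteq_atLeastAtMost_iff)
    moreover have "(\<lambda>n. LINT x|lborel. indicator {a<..<b} x * (\<phi> n x * V x)) \<longlonglongrightarrow> (LINT x|lborel. indicator {s<..t} x * V x)"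
    proof (rule integral_dominated_convergence[where w = "\<lambda>x. \<bar>V x\<bar>"])
      have lim: "(\<lambda>n. \<phi> n x) \<longlonglongrightarrow> indicator {s<..t} x" for x
      proof -
        \<comment> \<open>The half-line is open because the step vanishes at 0; the limit of the
          plateaus is therefore half-open, and the null point s is added at the end.\<close>
        have big: "(\<lambda>n. \<psi> ((x - c) / \<epsilon> n)) \<longlonglongrightarrow> indicator {c<..} x" for c
        proof (cases "c < x")
          case True
          have "\<forall>\<^sub>F n in sequentially. \<epsilon> n < x - c"
            using order_tendstoD(2)[OF \<epsilon>_lim, of "x - c"] True by simp
          then have "\<forall>\<^sub>F n in sequentially. \<psi> ((x - c) / \<epsilon> n) = indicator {c<..} x"
          proof eventually_elim
            case (elim n)
            then show ?case using True \<epsilon>(1)[of n] by (simp add: \<psi>(4))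
          qed
          then show ?thesis by (rule tendsto_eventually)
        next
          case False
          then have "(x - c) / \<epsilon> n \<le> 0" for n
            using \<epsilon>(1)[of n] by (simp add: field_simps)
          with False show ?thesis by (simp add: \<psi>(3))
        qed
        have "(\<lambda>n. \<phi> n x) \<longlonglongrightarrow> indicator {s<..} x - indicator {t<..} x"
          unfolding \<phi>_def by (intro tendsto_diff big)
        also have "indicator {s<..} x - indicator {t<..} x = (indicator {s<..t} x :: real)"
          using st by (auto simp: indicator_def)
        finally show ?thesis .
      qed
      have "(\<lambda>n. indicator {a<..<b} x * (\<phi> n x * V x)) \<longlonglongrightarrow> indicator {a<..<b} x * (indicator {s<..t} x * V x)" for x
        by (intro tendsto_mult lim tendsto_const)
      moreover have "indicator {a<..<b} x * (indicator {s<..t} x * V x) = indicator {s<..t} x * V x" for x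
        using st by (auto simp: indicator_def)
      ultimately show "AE x in lborel. (\<lambda>n. indicator {a<..<b} x * (\<phi> n x * V x)) \<longlonglongrightarrow> indicator {s<..t} x * V x"
        by simp
      show "AE x in lborel. norm (indicator {a<..<b} x * (\<phi> n x * V x)) \<le> \<bar>V x\<bar>" for n
        using \<phi>_bound[of n] by (auto simp: abs_mult indicator_def intro!: mult_left_le_one_le)
    qed (use V(1) in auto)
    moreover have "(LINT x|lborel. indicator {s<..t} x * V x) = (LINT x:{s..t}|lborel. V x)"
      unfolding set_lebesgue_integral_def using AE_lborel_singleton[of s]
      by (intro integral_cong_AE) (auto elim!: eventually_mono simp: indicator_def)
    ultimately show ?thesis
      by (auto intro!: tendsto_minus)
  qed
  moreover have "(LINT x:{a<..<b}|lebesgue. u x * deriv (\<phi> n) x) = - (LINT x:{a<..<b}|lebesgue. v x * \<phi> n x)" for n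
    using weak(1) test by (simp add: has_weak_derivative_def)
  ultimately have "u s - u t = - (LINT x:{s..t}|lborel. V x)"
    using LIMSEQ_unique by simp
  then show ?thesis by simp
qed

text \<open>The difference \<open>D\<close> between u and the indefinite integral of
  \<open>V\<close> is constant on the open interval, and continuity on [a,b] carries this to both
  endpoints.\<close>

lemma weak_derivative_integral:
  assumes "a < b" and t: "t \<in> {a..b}"
    and u: "continuous_on {a..b} u"
    and weak: "has_weak_derivative a b u v" "v \<in> L2 a b"
    and V: "integrable lborel V" "AE x in lborel. indicator {a<..<b} x * v x = V x"
  shows "u t - u a = (LINT x:{a..t}|lborel. V x)"
proof -
  have int: "set_integrable lborel {c..d} V" for c d
    using V(1) unfolding set_integrable_def by (intro integrable_mult_indicator) auto
  note eq = set_borel_integral_eq_integral[OF int]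
  define D where "D x = u x - integral {a..x} V" for x
  have cont: "continuous_on {a..b} D"
    unfolding D_def by (intro continuous_intros u indefinite_integral_continuous_1 eq(1))
  have step: "D x = D y" if "a < x" "x < y" "y < b" for x y
  proof -
    have "integral {a..y} V = integral {a..x} V + integral {x..y} V"
      using that by (intro Henstock_Kurzweil_Integration.integral_combine[symmetric] eq(1)) auto
    then show ?thesis
      using weak_derivative_integral_open[OF that u weak V] by (simp add: D_def eq(2))
  qed
  define m where "m = (a + b) / 2"
  have m: "a < m" "m < b" using \<open>a < b\<close> by (auto simp: m_def)
  have "D x = D m" if "x \<in> {a<..<b}" for x
    using that m step[of x m] step[of m x, symmetric]
    by (metis greaterThanLessThan_iff linorder_neq_iff)
  moreover have "closure {a<..<b} = {a..b}"
    using \<open>a < b\<close> by (simp add: closure_greaterThanLessThan)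
  ultimately have "D x = D m" if "x \<in> {a..b}" for x
    using continuous_constant_on_closure[of "{a<..<b}" D "D m" x] cont that by simp
  then have "D t = D a" using t \<open>a < b\<close> by simp
  then show ?thesis by (simp add: D_def eq(2))
qed

section \<open>Abel integrals\<close>

text \<open>The antiderivative is -(t - r)^\<alpha> / \<alpha>. For x = t the integrand blows up at
  the right endpoint, so differentiability is used only in the interior.\<close>

lemma abel_kernel_has_integral:
  fixes \<alpha> :: real
  assumes "0 < \<alpha>" "a \<le> x" "x \<le> t"
  shows "((\<lambda>r. (t - r) powr (\<alpha> - 1)) has_integral ((t - a) powr \<alpha> - (t - x) powr \<alpha>) / \<alpha>) {a..x}"
proof -
  have "((\<lambda>r. (t - r) powr (\<alpha> - 1)) has_integral (- ((t - x) powr \<alpha> / \<alpha>) - - ((t - a) powr \<alpha> / \<alpha>))) {a..x}"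
  proof (rule fundamental_theorem_of_calculus_interior)
    show "continuous_on {a..x} (\<lambda>r. - ((t - r) powr \<alpha> / \<alpha>))"
      using assms by (intro continuous_intros continuous_on_powr') auto
    fix r assume "r \<in> {a<..<x}"
    then have "t - r > 0" using assms by simp
    then have "((\<lambda>r. - ((t - r) powr \<alpha> / \<alpha>)) has_real_derivative (t - r) powr (\<alpha> - 1)) (at r)"
      using assms(1) by (auto intro!: derivative_eq_intros)
    then show "((\<lambda>r. - ((t - r) powr \<alpha> / \<alpha>)) has_vector_derivative (t - r) powr (\<alpha> - 1)) (at r)"
      by (simp add: has_real_derivative_iff_has_vector_derivative)
  qed (use assms in auto)
  then show ?thesis by (simp add: diff_divide_distrib)
qed

lemma abel_integrable:
  fixes \<alpha> :: real
  assumes "0 < \<alpha>" "x \<le> t" "continuous_on {a..x} h"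
  shows "(\<lambda>r. (t - r) powr (\<alpha> - 1) * h r) absolutely_integrable_on {a..x}"
proof (cases "a \<le> x")
  case True
  have "(\<lambda>r. (t - r) powr (\<alpha> - 1)) absolutely_integrable_on {a..x}"
    using abel_kernel_has_integral[OF assms(1) True assms(2)]
    by (intro nonnegative_absolutely_integrable_1) (auto simp: integrable_on_def)
  then have "(\<lambda>r. h r * (t - r) powr (\<alpha> - 1)) absolutely_integrable_on {a..x}"
    using assms(3) compact_imp_bounded[OF compact_continuous_image[OF assms(3) compact_Icc]]
    by (intro absolutely_integrable_bounded_measurable_product_real)
      (auto intro: continuous_imp_measurable_on_sets_lebesgue)
  then show ?thesis by (simp add: mult.commute)
qed simp

text \<open>For \<open>x < t\<close> the ratio of the kernels \<open>(t - r) powr (\<alpha> - 1)\<close> and \<open>(x - r) powr (\<alpha> - 1)\<close> is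
  decreasing in \<open>r\<close> with values in \<open>[0, 1]\<close>, so that a one-sided bound passes from \<open>x\<close> to \<open>t\<close>
  by the second mean value theorem.\<close>

lemma abel_integral_lower_bound_mono:
  fixes \<alpha> :: real
  assumes \<alpha>: "0 < \<alpha>" "\<alpha> < 1" and xt: "x \<le> t" and h: "continuous_on {a..x} h" and "e \<ge> 0"
    and lb: "\<And>s. s \<in> {a..x} \<Longrightarrow> integral {a..s} (\<lambda>r. (x - r) powr (\<alpha> - 1) * h r) \<ge> - e"
    and s: "s \<in> {a..x}"
  shows "integral {a..s} (\<lambda>r. (t - r) powr (\<alpha> - 1) * h r) \<ge> - e"
proof (cases "x = t")
  case True
  then show ?thesis using lb[OF s] by simp
next
  case False
  with xt have "x < t" by simp
  define f where "f r = (x - r) powr (\<alpha> - 1) * h r" for r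
  \<comment> \<open>This is the ratio of the kernel at t to the kernel at x.\<close>
  define \<rho> where "\<rho> r = ((x - r) / (t - r)) powr (1 - \<alpha>)" for r
  have f: "f integrable_on {a..s}"
    unfolding f_def using s
    by (intro set_lebesgue_integral_eq_integral(1) abel_integrable \<alpha>(1) continuous_on_subset[OF h]) auto
  \<comment> \<open>The second mean value theorem is applied to an increasing function, hence to the
    negative of \<rho>.\<close>
  have mono: "- \<rho> r \<le> - \<rho> r'" if "a \<le> r" "r \<le> r'" "r' \<le> s" for r r'
  proof -
    have "0 \<le> (t - x) * (r' - r)"
      using that \<open>x < t\<close> by simp
    then have "(x - r') * (t - r) \<le> (x - r) * (t - r')"
      by (simp add: algebra_simps)
    then have "(x - r') / (t - r') \<le> (x - r) / (t - r)"
      using that s \<open>x < t\<close> by (simp add: divide_simps)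
    then show ?thesis
      unfolding \<rho>_def using that s \<open>x < t\<close> \<alpha> by (auto intro!: powr_mono2)
  qed
  obtain c where c: "c \<in> {a..s}"
    "((\<lambda>r. - \<rho> r * f r) has_integral (- \<rho> a * integral {a..c} f + - \<rho> s * integral {c..s} f)) {a..s}"
    by (rule second_mean_value_theorem_full[where g = "\<lambda>r. - \<rho> r", OF f]) (use s mono in \<open>simp, blast+\<close>)
  \<comment> \<open>The factorization of the kernel through \<rho> can fail only at r = x, where
    \<open>0 powr (\<alpha> - 1)\<close> is 0; a single point is removed.\<close>
  have "((\<lambda>r. - ((t - r) powr (\<alpha> - 1) * h r)) has_integral (- \<rho> a * integral {a..c} f + - \<rho> s * integral {c..s} f)) {a..s}"
  proof (rule has_integral_spike_finite[OF _ _ c(2)])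
    fix r assume r: "r \<in> {a..s} - {x}"
    then have "(x - r) powr (1 - \<alpha>) * (x - r) powr (\<alpha> - 1) = 1"
      using s by (simp add: powr_add[symmetric])
    moreover have "(t - r) powr (1 - \<alpha>) * (t - r) powr (\<alpha> - 1) = 1"
      using r s \<open>x < t\<close> by (simp add: powr_add[symmetric])
    ultimately have "\<rho> r * (x - r) powr (\<alpha> - 1) = (t - r) powr (\<alpha> - 1)"
      using r s \<open>x < t\<close> by (simp add: \<rho>_def powr_divide field_simps)
    then show "- ((t - r) powr (\<alpha> - 1) * h r) = - \<rho> r * f r"
      by (simp add: f_def flip: mult.assoc)
  qed simp
  from integral_unique[OF this] have "- integral {a..s} (\<lambda>r. (t - r) powr (\<alpha> - 1) * h r)
      = - \<rho> a * integral {a..c} f + - \<rho> s * integral {c..s} f"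
    by simp
  moreover have "integral {a..s} f = integral {a..c} f + integral {c..s} f"
    using c(1) f by (simp add: Henstock_Kurzweil_Integration.integral_combine)
  \<comment> \<open>Regrouping gives a combination of two partial integrals at x, each at least -e,
    with nonnegative weights of total \<open>\<rho> a\<close> \<le> 1.\<close>
  ultimately have "integral {a..s} (\<lambda>r. (t - r) powr (\<alpha> - 1) * h r)
      = (\<rho> a - \<rho> s) * integral {a..c} f + \<rho> s * integral {a..s} f"
    by (simp add: algebra_simps)
  also have "\<dots> \<ge> (\<rho> a - \<rho> s) * - e + \<rho> s * - e"
    using mono[of a s] s c(1) lb[of c] lb[of s]
    by (intro add_mono mult_left_mono) (auto simp: f_def[abs_def] \<rho>_def)
  also have "(\<rho> a - \<rho> s) * - e + \<rho> s * - e = - (\<rho> a * e)"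
    by (simp add: algebra_simps)
  finally have "integral {a..s} (\<lambda>r. (t - r) powr (\<alpha> - 1) * h r) \<ge> - (\<rho> a * e)" .
  moreover have "\<rho> a * e \<le> 1 * e"
    using s \<open>x < t\<close> \<alpha> \<open>e \<ge> 0\<close>
    by (intro mult_right_mono) (auto simp: \<rho>_def intro!: powr_le1)
  ultimately show ?thesis by simp
qed

text \<open>For r < s the kernel decreases when s is replaced by t, and the total decrease is
  ((s-a)^\<alpha> - (t-a)^\<alpha> + (t-s)^\<alpha>) / \<alpha> \<le> (t-s)^\<alpha> / \<alpha>.
  Multiplied by the bound M on |h|, this limits the loss.\<close>

lemma abel_integral_increment:
  fixes \<alpha> :: real
  assumes \<alpha>: "0 < \<alpha>" "\<alpha> < 1" and st: "a \<le> s" "s \<le> t" and h: "continuous_on {a..s} h"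
    and M: "\<And>r. r \<in> {a..s} \<Longrightarrow> \<bar>h r\<bar> \<le> M"
  shows "integral {a..s} (\<lambda>r. (t - r) powr (\<alpha> - 1) * h r)
    \<ge> integral {a..s} (\<lambda>r. (s - r) powr (\<alpha> - 1) * h r) - M * ((t - s) powr \<alpha> / \<alpha>)"
proof -
  define d where "d r = (s - r) powr (\<alpha> - 1) - (t - r) powr (\<alpha> - 1)" for r
  define D where "D = ((s - a) powr \<alpha> - (s - s) powr \<alpha>) / \<alpha> - ((t - a) powr \<alpha> - (t - s) powr \<alpha>) / \<alpha>"
  define I where "I x = integral {a..s} (\<lambda>r. (x - r) powr (\<alpha> - 1) * h r)" for x
  have M0: "M \<ge> 0" using M[of a] st by force
  have I: "((\<lambda>r. (x - r) powr (\<alpha> - 1) * h r) has_integral I x) {a..s}" if "x \<ge> s" for x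
    unfolding I_def by (intro integrable_integral set_lebesgue_integral_eq_integral(1) abel_integrable \<alpha> that h)
  have "((\<lambda>r. d r * h r) has_integral I s - I t) {a..s}"
    using has_integral_diff[OF I[of s] I[of t]] st by (simp add: d_def left_diff_distrib)
  \<comment> \<open>At r = s the value \<open>0 powr (\<alpha> - 1)\<close> is 0, so
    \<open>d\<close> may be negative there; the point is taken out before the integrands are
    compared.\<close>
  then have 1: "((\<lambda>r. if r = s then 0 else d r * h r) has_integral I s - I t) {a..s}"
    by (rule has_integral_spike_finite[where S = "{s}", rotated 2]) auto
  have "(d has_integral D) {a..s}"
    unfolding d_def[abs_def] D_def by (intro has_integral_diff abel_kernel_has_integral \<alpha> st order_refl)
  then have "((\<lambda>r. M * d r) has_integral M * D) {a..s}"
    by (rule has_integral_mult_right)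
  then have 2: "((\<lambda>r. if r = s then 0 else M * d r) has_integral M * D) {a..s}"
    by (rule has_integral_spike_finite[where S = "{s}", rotated 2]) auto
  have "I s - I t \<le> M * D"
  proof (rule has_integral_le[OF 1 2])
    fix r assume r: "r \<in> {a..s}"
    show "(if r = s then 0 else d r * h r) \<le> (if r = s then 0 else M * d r)"
    proof (cases "r = s")
      case False
      then have "d r \<ge> 0"
        using r st \<alpha> by (auto simp: d_def intro!: powr_mono2')
      then have "h r * d r \<le> M * d r"
        using M[OF r] by (intro mult_right_mono) auto
      then show ?thesis using False by (simp add: mult.commute)
    qed simp
  qed
  also have "D \<le> (t - s) powr \<alpha> / \<alpha>"
    using \<alpha> st powr_mono2[of \<alpha> "s - a" "t - a"] by (simp add: D_def divide_simps)
  then have "M * D \<le> M * ((t - s) powr \<alpha> / \<alpha>)"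
    using M0 by (rule mult_left_mono)
  finally show ?thesis by (simp add: I_def)
qed

text \<open>The bound \<open>integral {a..s} (\<lambda>r. (x - r) powr (\<alpha> - 1) * h r) \<ge> - (c + \<epsilon>)\<close> for all \<open>s \<le> x\<close> is
  carried from \<open>x\<close> to \<open>x + \<delta>\<close>: past \<open>x\<close>, up to the last point \<open>s'\<close> with \<open>y s' \<ge> 0\<close> the slack \<open>\<epsilon>\<close>
  absorbs the Hoelder error of the kernel, and beyond \<open>s'\<close> the integrand is nonnegative.\<close>

lemma abel_comparison:
  fixes \<alpha> :: real
  assumes \<alpha>: "0 < \<alpha>" "\<alpha> < 1" and h: "continuous_on {a..b} h" and y: "continuous_on {a..b} y"
    and eq: "\<And>t. t \<in> {a..b} \<Longrightarrow> y t = c + integral {a..t} (\<lambda>r. (t - r) powr (\<alpha> - 1) * h r)"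
    and "c \<ge> 0"
    and sign: "\<And>t. t \<in> {a..b} \<Longrightarrow> y t < 0 \<Longrightarrow> h t \<ge> 0"
    and t: "t \<in> {a..b}"
  shows "y t \<ge> 0"
proof (rule field_le_epsilon)
  fix \<epsilon> :: real assume \<epsilon>: "\<epsilon> > 0"
  define F where "F s x = integral {a..s} (\<lambda>r. (x - r) powr (\<alpha> - 1) * h r)" for s x
  have int: "(\<lambda>r. (x - r) powr (\<alpha> - 1) * h r) integrable_on {a..s}" if "s \<le> x" "s \<le> b" for s x
    using that by (intro set_lebesgue_integral_eq_integral(1) abel_integrable \<alpha> continuous_on_subset[OF h]) auto
  obtain M where M: "\<forall>r\<in>{a..b}. \<bar>h r\<bar> \<le> M"
    using compact_imp_bounded[OF compact_continuous_image[OF h compact_Icc]]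
    by (auto simp: bounded_iff)
  have M0: "M \<ge> 0" using M t by force
  \<comment> \<open>This solves (M + 1) \<delta>^\<alpha> / \<alpha> = \<epsilon>, so the loss in
    \<open>abel_integral_increment\<close> over a distance at most \<delta> is at most \<epsilon>.
    The summand 1 keeps the denominator positive. Since \<delta> does not depend on the point
    reached, finitely many steps lead to t.\<close>
  define \<delta> where "\<delta> = (\<epsilon> * \<alpha> / (M + 1)) powr (1 / \<alpha>)"
  have \<delta>: "\<delta> > 0" using \<epsilon> \<alpha> M0 by (simp add: \<delta>_def)
  have small: "M * (d powr \<alpha> / \<alpha>) \<le> \<epsilon>" if "0 \<le> d" "d \<le> \<delta>" for d
  proof -
    have "d powr \<alpha> \<le> \<delta> powr \<alpha>"
      using that \<alpha> by (intro powr_mono2) auto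
    also have "\<delta> powr \<alpha> = \<epsilon> * \<alpha> / (M + 1)"
      using \<epsilon> \<alpha> M0 by (simp add: \<delta>_def powr_powr)
    finally have "M * (d powr \<alpha> / \<alpha>) \<le> M * (\<epsilon> * \<alpha> / (M + 1) / \<alpha>)"
      using M0 \<alpha> by (intro mult_left_mono divide_right_mono) auto
    also have "\<dots> \<le> \<epsilon>"
      using \<alpha> M0 \<epsilon> by (simp add: divide_simps)
    finally show ?thesis .
  qed
  \<comment> \<open>All upper limits s \<le> x are included because the passage to a later kernel by
    the mean value theorem consumes bounds on every partial integral.\<close>
  define P where "P x \<longleftrightarrow> (\<forall>s\<in>{a..x}. F s x \<ge> - (c + \<epsilon>))" for x
  have step: "P x'" if x: "a \<le> x" "x \<le> x'" "x' \<le> b" "x' \<le> x + \<delta>" and "P x" for x x'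
  proof -
    have before: "F s x' \<ge> - (c + \<epsilon>)" if "s \<in> {a..x}" for s
      unfolding F_def
    proof (rule abel_integral_lower_bound_mono[OF \<alpha> x(2) _ _ _ that])
      show "continuous_on {a..x} h" using x by (intro continuous_on_subset[OF h]) auto
    qed (use \<open>c \<ge> 0\<close> \<epsilon> \<open>P x\<close> in \<open>auto simp: P_def F_def\<close>)
    have nonneg: "F s x' \<ge> - (c + \<epsilon>)" if s: "s \<in> {x..x'}" "y s \<ge> 0" for s
    proof -
      have "F s s \<ge> - c" using eq[of s] s x by (simp add: F_def)
      moreover have "F s x' \<ge> F s s - M * ((x' - s) powr \<alpha> / \<alpha>)"
        unfolding F_def using s x M
        by (intro abel_integral_increment \<alpha> continuous_on_subset[OF h]) auto
      moreover have "M * ((x' - s) powr \<alpha> / \<alpha>) \<le> \<epsilon>"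
        using s x by (intro small) auto
      ultimately show ?thesis by simp
    qed
    have after: "F s x' \<ge> - (c + \<epsilon>)" if s: "s \<in> {x..x'}" for s
    proof -
      define S where "S = {r \<in> {x..s}. y r \<ge> 0}"
      have neg: "y r < 0" if "r \<in> {x..s}" "r \<notin> S" for r
        using that by (auto simp: S_def)
      \<comment> \<open>If y is negative on all of [x,s], the default is s' = x, where the bound
        carried over from x takes the place of \<open>nonneg\<close>.\<close>
      obtain s' where s': "s' \<in> {x..s}" "s' = x \<or> y s' \<ge> 0" "\<forall>r\<in>{s'<..s}. y r < 0"
      proof (cases "S = {}")
        case True
        then show ?thesis using s by (intro that[of x]) (auto intro: neg)
      next
        case False
        have "closed S"
          using continuous_closed_preimage[OF continuous_on_subset[OF y] closed_atLeastAtMost closed_atLeast, of x s 0] s x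
          by (simp add: S_def Int_def vimage_def)
        then have "Sup S \<in> S"
          using False by (intro closed_contains_Sup) (auto simp: S_def bdd_above_def)
        moreover have "r \<notin> S" if "r > Sup S" for r
          using that cSup_upper[of r S] by (auto simp: S_def bdd_above_def)
        ultimately show ?thesis
          by (intro that[of "Sup S"] ballI neg) (auto simp: S_def)
      qed
      have "F s' x' \<ge> - (c + \<epsilon>)"
        using s' s before[of x] nonneg[of s'] x by auto
      moreover have "F s x' = F s' x' + integral {s'..s} (\<lambda>r. (x' - r) powr (\<alpha> - 1) * h r)"
        unfolding F_def using s s' x int[of s x'] by (simp add: Henstock_Kurzweil_Integration.integral_combine)
      moreover have "integral {s'..s} (\<lambda>r. (x' - r) powr (\<alpha> - 1) * h r) \<ge> 0"
      proof -
        have "(\<lambda>r. (x' - r) powr (\<alpha> - 1) * h r) integrable_on {s'..s}"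
          using int[of s x'] by (rule integrable_on_subinterval) (use s s' x in auto)
        \<comment> \<open>The left endpoint is discarded, because y is known to be negative only to
          the right of s'.\<close>
        then have "((\<lambda>r. if r = s' then 0 else (x' - r) powr (\<alpha> - 1) * h r) has_integral
            integral {s'..s} (\<lambda>r. (x' - r) powr (\<alpha> - 1) * h r)) {s'..s}"
          by (intro has_integral_spike_finite[where S = "{s'}", OF _ _ integrable_integral]) auto
        then show ?thesis
          by (rule has_integral_nonneg) (use s s' x in \<open>auto intro!: mult_nonneg_nonneg sign\<close>)
      qed
      ultimately show ?thesis by linarith
    qed
    show ?thesis
      unfolding P_def
    proof
      fix s assume "s \<in> {a..x'}"
      then show "F s x' \<ge> - (c + \<epsilon>)"
        using before[of s] after[of s] by (cases "s \<le> x") auto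
    qed
  qed
  have ladder: "x \<in> {a..b} \<longrightarrow> x \<le> a + real n * \<delta> \<longrightarrow> P x" for n x
  proof (induction n arbitrary: x)
    case 0
    then show ?case using \<open>c \<ge> 0\<close> \<epsilon> by (auto simp: P_def F_def)
  next
    case (Suc n)
    show ?case
    proof (intro impI)
      assume x: "x \<in> {a..b}" "x \<le> a + real (Suc n) * \<delta>"
      then have "P (max a (x - \<delta>))"
        using Suc.IH[of "max a (x - \<delta>)"] \<delta> by (auto simp: algebra_simps max_def)
      then show "P x"
        by (rule step[rotated 4]) (use x \<delta> in auto)
    qed
  qed
  obtain n where "t - a < real n * \<delta>"
    using reals_Archimedean3[OF \<delta>] by blast
  then have "P t"
    using t ladder[of t n] by simp
  then have "F t t \<ge> - (c + \<epsilon>)"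
    using t by (simp add: P_def)
  then show "0 \<le> y t + \<epsilon>"
    using eq[OF t] by (simp add: F_def)
qed

section \<open>The Mittag-Leffler function\<close>

text \<open>Log-convexity of Gamma at x + 1 = \<alpha> (x + \<alpha>) + (1 - \<alpha>) (x + \<alpha>
  + 1) gives Wendel's inequality Gamma(x + 1) \<le> Gamma(x + \<alpha>) (x + \<alpha>)^(1 -
  \<alpha>).\<close>

lemma Gamma_quotient_le:
  fixes \<alpha> x :: real
  assumes "0 < \<alpha>" "\<alpha> \<le> 1" "x > 0"
  shows "Gamma x / Gamma (x + \<alpha>) \<le> (x + \<alpha>) powr (1 - \<alpha>) / x"
proof -
  have "(ln \<circ> Gamma) ((1 - (1 - \<alpha>)) *\<^sub>R (x + \<alpha>) + (1 - \<alpha>) *\<^sub>R (x + \<alpha> + 1))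
      \<le> (1 - (1 - \<alpha>)) * (ln \<circ> Gamma) (x + \<alpha>) + (1 - \<alpha>) * (ln \<circ> Gamma) (x + \<alpha> + 1)"
    using assms by (intro convex_onD[OF log_convex_Gamma_real]) auto
  moreover have "(1 - (1 - \<alpha>)) *\<^sub>R (x + \<alpha>) + (1 - \<alpha>) *\<^sub>R (x + \<alpha> + 1) = x + 1"
    by (simp add: algebra_simps)
  moreover have "Gamma (x + \<alpha> + 1) = (x + \<alpha>) * Gamma (x + \<alpha>)" "Gamma (x + 1) = x * Gamma x"
    using assms by (auto intro!: Gamma_plus1 elim!: nonpos_Ints_cases)
  moreover have "Gamma x > 0" "Gamma (x + \<alpha>) > 0"
    using assms by auto
  ultimately have "ln (x * Gamma x) \<le> \<alpha> * ln (Gamma (x + \<alpha>)) + (1 - \<alpha>) * (ln (x + \<alpha>) + ln (Gamma (x + \<alpha>)))"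
    using assms by (simp add: ln_mult)
  also have "\<dots> = ln (Gamma (x + \<alpha>)) + (1 - \<alpha>) * ln (x + \<alpha>)"
    by (simp add: algebra_simps)
  also have "\<dots> = ln (Gamma (x + \<alpha>) * (x + \<alpha>) powr (1 - \<alpha>))"
    using assms less_imp_neq[OF \<open>Gamma (x + \<alpha>) > 0\<close>] by (simp add: ln_mult ln_powr)
  finally have "x * Gamma x \<le> Gamma (x + \<alpha>) * (x + \<alpha>) powr (1 - \<alpha>)"
    using assms \<open>Gamma x > 0\<close> \<open>Gamma (x + \<alpha>) > 0\<close> by (subst (asm) ln_le_cancel_iff) auto
  then show ?thesis
    using assms \<open>Gamma (x + \<alpha>) > 0\<close> by (simp add: field_simps)
qed

text \<open>Consecutive terms have the ratio |z| Gamma(x) / Gamma(x + \<alpha>) with x = \<alpha> k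
  + 1, which tends to 0 by \<open>Gamma_quotient_le\<close>.\<close>

lemma summable_mittag_leffler:
  assumes \<alpha>: "0 < \<alpha>" "\<alpha> \<le> 1"
  shows "summable (\<lambda>k. norm (z ^ k / Gamma (\<alpha> * real k + 1)))"
proof -
  have "(\<lambda>k. \<bar>z\<bar> * ((\<alpha> * real k + 1 + \<alpha>) powr (1 - \<alpha>) / (\<alpha> * real k + 1))) \<longlonglongrightarrow> 0"
    using \<alpha> by real_asymp
  then have "\<forall>\<^sub>F k in sequentially. \<bar>z\<bar> * ((\<alpha> * real k + 1 + \<alpha>) powr (1 - \<alpha>) / (\<alpha> * real k + 1)) < 1 / 2"
    by (rule order_tendstoD) simp
  then obtain N where N: "\<And>k. k \<ge> N \<Longrightarrow> \<bar>z\<bar> * ((\<alpha> * real k + 1 + \<alpha>) powr (1 - \<alpha>) / (\<alpha> * real k + 1)) < 1 / 2"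
    by (auto simp: eventually_sequentially)
  show ?thesis
  proof (rule summable_ratio_test[of "1/2" N])
    fix k assume "N \<le> k"
    define x where "x = \<alpha> * real k + 1"
    have x: "x > 0" using \<alpha> by (simp add: x_def add_nonneg_pos)
    have pos: "Gamma x > 0" "Gamma (x + \<alpha>) > 0"
      using x \<alpha> by auto
    have "\<bar>z\<bar> * (Gamma x / Gamma (x + \<alpha>)) \<le> \<bar>z\<bar> * ((x + \<alpha>) powr (1 - \<alpha>) / x)"
      using Gamma_quotient_le[OF \<alpha> x] by (intro mult_left_mono) auto
    also have "\<dots> \<le> 1 / 2"
      using N[OF \<open>N \<le> k\<close>] by (simp add: x_def)
    finally have "\<bar>z\<bar> * (Gamma x / Gamma (x + \<alpha>)) * (\<bar>z\<bar> ^ k / Gamma x) \<le> 1 / 2 * (\<bar>z\<bar> ^ k / Gamma x)"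
      using pos by (intro mult_right_mono) auto
    moreover have "\<alpha> * real (Suc k) + 1 = x + \<alpha>"
      by (simp add: x_def algebra_simps)
    ultimately show "norm (norm (z ^ Suc k / Gamma (\<alpha> * real (Suc k) + 1)))
        \<le> 1 / 2 * norm (norm (z ^ k / Gamma (\<alpha> * real k + 1)))"
      using pos by (simp add: abs_mult power_abs flip: x_def)
  qed simp
qed

lemma mittag_leffler_sums:
  assumes "0 < \<alpha>" "\<alpha> \<le> 1"
  shows "(\<lambda>k. z ^ k / Gamma (\<alpha> * real k + 1)) sums mittag_leffler \<alpha> z"
  unfolding mittag_leffler_def
  using summable_norm_cancel[OF summable_mittag_leffler[OF assms]] by (rule summable_sums)

lemma isCont_mittag_leffler:
  assumes "0 < \<alpha>" "\<alpha> \<le> 1"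
  shows "isCont (mittag_leffler \<alpha>) z"
proof -
  have "isCont (\<lambda>z. \<Sum>k. (1 / Gamma (\<alpha> * real k + 1)) * z ^ k) z"
    using summable_norm_cancel[OF summable_mittag_leffler[OF assms]]
    by (intro isCont_powser_converges_everywhere) simp
  then show ?thesis
    by (simp add: mittag_leffler_def[abs_def])
qed

text \<open>For \<beta> = \<alpha> k this Abel integral of a power turns the k-th term of the
  Mittag-Leffler series into a multiple of the next one.\<close>

lemma beta_integral_scaled:
  fixes r \<alpha> \<beta> :: real
  assumes "r > 0" "\<alpha> > 0" "\<beta> \<ge> 0"
  shows "((\<lambda>s. (r - s) powr (\<alpha> - 1) * s powr \<beta>) has_integral r powr (\<alpha> + \<beta>) * Beta \<alpha> (\<beta> + 1)) {0..r}"
proof -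
  have "((\<lambda>s. s powr \<beta> * (1 - s) powr (\<alpha> - 1)) has_integral Beta (\<beta> + 1) \<alpha>) {0..1}"
    using has_integral_Beta_real[of "\<beta> + 1" \<alpha>] assms by simp
  from has_integral_stretch_real[OF this, of "1 / r"]
  have "((\<lambda>s. (s / r) powr \<beta> * (1 - s / r) powr (\<alpha> - 1)) has_integral r * Beta (\<beta> + 1) \<alpha>) ((\<lambda>x. x * r) ` {0..1})"
    using assms by simp
  also have "(\<lambda>x. x * r) ` {0..1} = {0..r}"
    using image_mult_atLeastAtMost[of r 0 1] assms by (simp add: mult.commute)
  finally have int: "((\<lambda>s. r powr (\<alpha> - 1 + \<beta>) * ((s / r) powr \<beta> * (1 - s / r) powr (\<alpha> - 1)))
      has_integral r powr (\<alpha> - 1 + \<beta>) * (r * Beta (\<beta> + 1) \<alpha>)) {0..r}"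
    by (rule has_integral_mult_right)
  have val: "r powr (\<alpha> - 1 + \<beta>) * (r * Beta (\<beta> + 1) \<alpha>) = r powr (\<alpha> + \<beta>) * Beta \<alpha> (\<beta> + 1)"
    using assms by (simp add: Beta_commute powr_add powr_diff)
  have pointwise: "r powr (\<alpha> - 1 + \<beta>) * ((s / r) powr \<beta> * (1 - s / r) powr (\<alpha> - 1))
      = (r - s) powr (\<alpha> - 1) * s powr \<beta>" if "s \<in> {0..r}" for s
  proof -
    have "1 - s / r = (r - s) / r" using assms by (simp add: field_simps)
    then show ?thesis
      using assms that by (simp add: powr_divide powr_add)
  qed
  show ?thesis
    unfolding val[symmetric] by (rule has_integral_eq[OF pointwise int])
qed

text \<open>Nonnegativity makes gauge integrability absolute, so values found by antiderivatives or
  the Beta integral become available for Fubini and for summation on \<open>lborel\<close>.\<close>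

lemma has_integral_nonneg_imp_lborel:
  fixes f :: "real \<Rightarrow> real"
  assumes f: "f \<in> borel_measurable borel" and A: "A \<in> sets borel"
    and int: "(f has_integral I) A" and nn: "\<And>x. x \<in> A \<Longrightarrow> f x \<ge> 0"
  shows "set_integrable lborel A f" "(LINT x:A|lborel. f x) = I"
proof -
  have "f absolutely_integrable_on A"
    using int nn by (intro nonnegative_absolutely_integrable_1) (auto simp: integrable_on_def)
  then show si: "set_integrable lborel A f"
    using f A by (simp add: set_integrable_def integrable_completion)
  show "(LINT x:A|lborel. f x) = I"
    using set_borel_integral_eq_integral(2)[OF si] integral_unique[OF int] by simp
qed

text \<open>Integration of the series term by term shifts the index by one: every term reappears as
  its successor, and only the constant term 1 is lost. Summability of the integrated absolute
  values, which form the same series for |\<kappa>|, justifies the interchange. For \<kappa> =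
  -\<alpha>/(1 - \<alpha>) this is the identity K + \<lambda> I^\<alpha> K = 1.\<close>

lemma mittag_leffler_resolvent:
  fixes \<alpha> \<kappa> r :: real
  assumes \<alpha>: "0 < \<alpha>" "\<alpha> \<le> 1" and "r \<ge> 0" "\<kappa> \<noteq> 0"
  shows "(LINT s:{0..r}|lborel. (r - s) powr (\<alpha> - 1) * mittag_leffler \<alpha> (\<kappa> * s powr \<alpha>))
    = Gamma \<alpha> / \<kappa> * (mittag_leffler \<alpha> (\<kappa> * r powr \<alpha>) - 1)"
proof (cases "r = 0")
  case True
  have "mittag_leffler \<alpha> 0 = 1"
    by (simp add: mittag_leffler_def powser_zero[of "\<lambda>k. 1 / Gamma (\<alpha> * real k + 1)", simplified])
  moreover have "(LINT s:{0..0}|lborel. (0 - s) powr (\<alpha> - 1) * mittag_leffler \<alpha> (\<kappa> * s powr \<alpha>)) = 0"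
    by (rule trans[OF set_lebesgue_integral_cong[where g = "\<lambda>_. 0"]]) auto
  ultimately show ?thesis using True \<alpha> by simp
next
  case False
  with \<open>r \<ge> 0\<close> have r: "r > 0" by simp
  define c where "c k = \<alpha> * real k + 1" for k
  have c: "c k > 0" for k using \<alpha> by (simp add: c_def add_nonneg_pos)
  define m where "m k s = (r - s) powr (\<alpha> - 1) * (s powr \<alpha>) ^ k" for k s
  define J where "J k = r powr (\<alpha> * real (Suc k)) * (Gamma \<alpha> * Gamma (c k) / Gamma (c (Suc k)))" for k
  have Gpos: "Gamma (c k) > 0" "Gamma \<alpha> > 0" for k using c \<alpha> by auto
  have m_int: "(m k has_integral J k) {0..r}" for k
  \<comment> \<open>For k = 0 the two forms of the power differ at s = 0: an empty product is 1, but
    \<open>0 powr 0\<close> is 0.\<close>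
  proof (rule has_integral_spike_finite[where S = "{0}"])
    have c_Suc: "\<alpha> * real k + 1 = c k" "\<alpha> + c k = c (Suc k)" "\<alpha> + \<alpha> * real k = \<alpha> * real (Suc k)"
      by (simp_all add: c_def algebra_simps)
    show "((\<lambda>s. (r - s) powr (\<alpha> - 1) * s powr (\<alpha> * real k)) has_integral J k) {0..r}"
      using beta_integral_scaled[OF r \<alpha>(1), of "\<alpha> * real k"] \<alpha>
      unfolding Beta_def c_Suc J_def by simp
    show "m k s = (r - s) powr (\<alpha> - 1) * s powr (\<alpha> * real k)" if "s \<in> {0..r} - {0}" for s
      using that by (simp add: m_def powr_powr[symmetric] powr_realpow)
  qed simp
  have m_meas [measurable]: "m k \<in> borel_measurable borel" for k
    unfolding m_def by measurable
  have m_nn: "m k s \<ge> 0" for k s by (simp add: m_def)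
  note m_lb = has_integral_nonneg_imp_lborel[OF m_meas _ m_int m_nn]
  define f where "f k s = (\<kappa> ^ k / Gamma (c k)) * (indicator {0..r} s * m k s)" for k s
  have f_int: "integrable lborel (f k)" for k
    using m_lb(1)[of k] unfolding f_def set_integrable_def by simp
  have f_norm: "norm (f k s) = (\<bar>\<kappa>\<bar> ^ k / Gamma (c k)) * (indicator {0..r} s * m k s)" for k s
    using m_nn by (simp add: f_def abs_mult power_abs abs_of_pos[OF Gpos(1)])
  have f_sums: "(\<lambda>k. f k s) sums (indicator {0..r} s * ((r - s) powr (\<alpha> - 1) * mittag_leffler \<alpha> (\<kappa> * s powr \<alpha>)))" for s
    using sums_mult[OF mittag_leffler_sums[OF \<alpha>, of "\<kappa> * s powr \<alpha>"], of "indicator {0..r} s * (r - s) powr (\<alpha> - 1)"]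
    by (simp add: f_def m_def c_def power_mult_distrib mult_ac)
  have f_summable: "summable (\<lambda>k. norm (f k s))" for s
    using summable_mult[OF summable_mittag_leffler[OF \<alpha>, of "\<kappa> * s powr \<alpha>"], of "indicator {0..r} s * (r - s) powr (\<alpha> - 1)"] c
    unfolding f_norm by (simp add: m_def power_mult_distrib power_abs abs_mult mult_ac less_imp_le[OF Gpos(1)] flip: c_def)
  \<comment> \<open>The bound variable \<kappa> shadows the fixed one, so that the formula serves
    both \<kappa> and its absolute value.\<close>
  have coeff: "\<kappa> ^ k / Gamma (c k) * J k = Gamma \<alpha> / \<kappa> * ((\<kappa> * r powr \<alpha>) ^ Suc k / Gamma (c (Suc k)))" if "\<kappa> \<noteq> 0" for k \<kappa>
  proof -
    have "r powr (\<alpha> * real (Suc k)) = (r powr \<alpha>) ^ Suc k"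
      using r by (simp add: powr_powr[symmetric] powr_realpow del: of_nat_Suc power_Suc)
    then show ?thesis
      using Gpos(1)[of k] that by (simp add: J_def power_mult_distrib)
  qed
  have sums1: "(\<lambda>k. integral\<^sup>L lborel (f k)) sums (LINT s|lborel. (\<Sum>k. f k s))"
  proof (rule sums_integral[OF f_int])
    have "(LINT s|lborel. norm (f k s)) = \<bar>\<kappa>\<bar> ^ k / Gamma (c k) * J k" for k
      unfolding f_norm using m_lb(2)[of k] by (simp add: set_lebesgue_integral_def)
    then have "(LINT s|lborel. norm (f k s))
        = Gamma \<alpha> / \<bar>\<kappa>\<bar> * ((\<bar>\<kappa>\<bar> * r powr \<alpha>) ^ Suc k / Gamma (c (Suc k)))" for k
      using coeff[of "\<bar>\<kappa>\<bar>" k] \<open>\<kappa> \<noteq> 0\<close> by simp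
    moreover have "summable (\<lambda>k. Gamma \<alpha> / \<bar>\<kappa>\<bar> * ((\<bar>\<kappa>\<bar> * r powr \<alpha>) ^ Suc k / Gamma (c (Suc k))))"
      using summable_norm_cancel[OF summable_mittag_leffler[OF \<alpha>]] unfolding c_def
      by (intro summable_mult) (subst summable_Suc_iff, blast)
    ultimately show "summable (\<lambda>k. LINT s|lborel. norm (f k s))"
      by simp
  qed (use f_summable in auto)
  have f_integral: "integral\<^sup>L lborel (f k) = Gamma \<alpha> / \<kappa> * ((\<kappa> * r powr \<alpha>) ^ Suc k / Gamma (c (Suc k)))" for k
    using m_lb(2)[of k] coeff[OF \<open>\<kappa> \<noteq> 0\<close>, of k]
    by (simp add: f_def[abs_def] set_lebesgue_integral_def del: power_Suc)
  have sums2: "(\<lambda>k. (\<kappa> * r powr \<alpha>) ^ Suc k / Gamma (c (Suc k))) sums (mittag_leffler \<alpha> (\<kappa> * r powr \<alpha>) - 1)"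
    using mittag_leffler_sums[OF \<alpha>, of "\<kappa> * r powr \<alpha>"] unfolding c_def
    by (subst sums_Suc_iff) simp
  have "(LINT s|lborel. (\<Sum>k. f k s)) = Gamma \<alpha> / \<kappa> * (mittag_leffler \<alpha> (\<kappa> * r powr \<alpha>) - 1)"
    by (rule sums_unique2[OF sums1[unfolded f_integral] sums_mult[OF sums2]])
  then show ?thesis
    using f_sums by (simp add: set_lebesgue_integral_def sums_iff)
qed

section \<open>The Volterra equation\<close>

lemma integrable_tensor_product:
  fixes f g :: "real \<Rightarrow> real"
  assumes "integrable lborel f" "integrable lborel g"
  shows "integrable (lborel \<Otimes>\<^sub>M lborel) (\<lambda>(x, y). f x * g y)"
proof (rule lborel_pair.Fubini_integrable)
  have [measurable]: "f \<in> borel_measurable borel" "g \<in> borel_measurable borel"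
    using assms by auto
  show "(\<lambda>(x, y). f x * g y) \<in> borel_measurable (lborel \<Otimes>\<^sub>M lborel)"
    by measurable
  show "integrable lborel (\<lambda>x. LINT y|lborel. norm (case (x, y) of (x, y) \<Rightarrow> f x * g y))"
    using assms by (simp add: abs_mult)
qed (use assms in auto)

text \<open>Associativity of convolution: the Abel integral of k * V equals R * V, where R is the
  Abel integral of k. Fubini applies on the triangle a \<le> x \<le> s \<le> t with the dominating
  product of M, the Abel kernel in s and |V x|; integrability of V suffices.\<close>

lemma abel_integral_convolution:
  fixes \<alpha> a t :: real and k V R :: "real \<Rightarrow> real"
  assumes "0 < \<alpha>" "a \<le> t" and V: "integrable lborel V" and k: "k \<in> borel_measurable borel"
    and M: "\<And>r. r \<in> {0..t - a} \<Longrightarrow> \<bar>k r\<bar> \<le> M"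
    and R: "\<And>r. r \<ge> 0 \<Longrightarrow> (LINT s:{0..r}|lborel. (r - s) powr (\<alpha> - 1) * k s) = R r"
  shows "set_integrable lborel {a..t} (\<lambda>s. (t - s) powr (\<alpha> - 1) * (LINT x:{a..s}|lborel. k (s - x) * V x))"
    and "(LINT s:{a..t}|lborel. (t - s) powr (\<alpha> - 1) * (LINT x:{a..s}|lborel. k (s - x) * V x))
      = (LINT x:{a..t}|lborel. R (t - x) * V x)"
proof -
  define A where "A s = indicator {a..t} s * (t - s) powr (\<alpha> - 1)" for s
  have A_int: "integrable lborel A"
    using has_integral_nonneg_imp_lborel(1)[OF _ _ abel_kernel_has_integral[OF assms(1,2) order_refl]]
    by (simp add: A_def[abs_def] set_integrable_def)
  have [measurable]: "A \<in> borel_measurable borel" "V \<in> borel_measurable borel" "k \<in> borel_measurable borel"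
    using A_int V k by auto
  define f where "f s x = A s * (if a \<le> x \<and> x \<le> s then k (s - x) * V x else 0)" for s x
  have "integrable (lborel \<Otimes>\<^sub>M lborel) (\<lambda>(s, x). (M * A s) * V x)"
    by (intro integrable_tensor_product V) (use A_int in simp)
  then have "integrable (lborel \<Otimes>\<^sub>M lborel) (\<lambda>(s, x). f s x)"
  proof (rule Bochner_Integration.integrable_bound)
    show "(\<lambda>(s, x). f s x) \<in> borel_measurable (lborel \<Otimes>\<^sub>M lborel)"
      unfolding f_def by measurable
    have "\<bar>f s x\<bar> \<le> \<bar>M * A s * V x\<bar>" for s x
    proof (cases "a \<le> x \<and> x \<le> s \<and> s \<le> t")
      case True
      then have "\<bar>k (s - x)\<bar> \<le> M" by (intro M) auto
      then have "\<bar>k (s - x)\<bar> * (\<bar>A s\<bar> * \<bar>V x\<bar>) \<le> \<bar>M\<bar> * (\<bar>A s\<bar> * \<bar>V x\<bar>)"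
        by (intro mult_right_mono) auto
      then show ?thesis using True by (simp add: f_def abs_mult mult_ac)
    qed (auto simp: f_def A_def)
    then show "AE p in lborel \<Otimes>\<^sub>M lborel. norm (case p of (s, x) \<Rightarrow> f s x) \<le> norm (case p of (s, x) \<Rightarrow> M * A s * V x)"
      by (auto split: prod.split)
  qed
  note fub = lborel_pair.Fubini_integral[OF this] lborel_pair.integrable_fst[OF this]
  have inner: "(LINT x|lborel. f s x) = indicator {a..t} s * ((t - s) powr (\<alpha> - 1) * (LINT x:{a..s}|lborel. k (s - x) * V x))" for s
  proof -
    have "f s x = A s * (indicator {a..s} x * (k (s - x) * V x))" for x
      by (simp add: f_def indicator_def)
    then show ?thesis by (simp add: set_lebesgue_integral_def A_def mult.assoc)
  qed
  have outer: "(LINT s|lborel. f s x) = indicator {a..t} x * (R (t - x) * V x)" for x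
  proof (cases "x \<in> {a..t}")
    case True
    have "(LINT s|lborel. f s x) = (LINT s|lborel. f (x + 1 * s) x)"
      by (subst lborel_integral_real_affine[of 1 _ x]) auto
    also have "(\<lambda>s. f (x + 1 * s) x) = (\<lambda>s. V x * (indicator {0..t - x} s * ((t - x - s) powr (\<alpha> - 1) * k s)))"
      using True by (auto simp: f_def A_def indicator_def fun_eq_iff diff_diff_eq)
    also have "(LINT s|lborel. V x * (indicator {0..t - x} s * ((t - x - s) powr (\<alpha> - 1) * k s))) = V x * R (t - x)"
      using R[of "t - x"] True by (simp add: set_lebesgue_integral_def)
    finally show ?thesis using True by simp
  next
    case False
    then have "f s x = 0" for s by (auto simp: f_def A_def)
    with False show ?thesis by simp
  qed
  show "set_integrable lborel {a..t} (\<lambda>s. (t - s) powr (\<alpha> - 1) * (LINT x:{a..s}|lborel. k (s - x) * V x))"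
    using fub(2) by (simp add: set_integrable_def inner)
  show "(LINT s:{a..t}|lborel. (t - s) powr (\<alpha> - 1) * (LINT x:{a..s}|lborel. k (s - x) * V x))
      = (LINT x:{a..t}|lborel. R (t - x) * V x)"
    using fub(1) by (simp add: set_lebesgue_integral_def inner outer)
qed

lemma weak_deriv_H1:
  assumes "u \<in> H1 a b"
  shows "weak_deriv a b u \<in> L2 a b" "has_weak_derivative a b u (weak_deriv a b u)"
  using someI_ex[of "\<lambda>v. v \<in> L2 a b \<and> has_weak_derivative a b u v"] assms
  by (auto simp: H1_def weak_deriv_def)

text \<open>The Abel integral of the convolution \<open>H\<close> is computed by
  \<open>abel_integral_convolution\<close> and \<open>mittag_leffler_resolvent\<close>, and the
  result is solved for u t - u a. The equation is given only on (a,b]; continuity of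
  \<open>G\<close> supplies the value at a.\<close>

lemma ABC_deriv_Volterra:
  assumes "a < b" and \<alpha>: "0 < \<alpha>" "\<alpha> < 1" and B: "B \<alpha> > 0"
    and u: "u \<in> H1 a b" "continuous_on {a..b} u" and G: "continuous_on {a..b} G"
    and eq: "\<forall>t\<in>{a<..b}. ABC_deriv B \<alpha> a b u t = G t"
  shows "G a = 0"
    and "\<And>t. t \<in> {a..b} \<Longrightarrow> u t - u a = (1 - \<alpha>) / B \<alpha> * G t
      + \<alpha> / (B \<alpha> * Gamma \<alpha>) * integral {a..t} (\<lambda>s. (t - s) powr (\<alpha> - 1) * G s)"
proof -
  define \<kappa> where "\<kappa> = - (\<alpha> / (1 - \<alpha>))"
  have \<kappa>: "\<kappa> < 0" using \<alpha> by (simp add: \<kappa>_def)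
  define k where "k r = mittag_leffler \<alpha> (\<kappa> * r powr \<alpha>)" for r
  have mittag_leffler_cont: "continuous_on UNIV (mittag_leffler \<alpha>)"
    using isCont_mittag_leffler[of \<alpha>] \<alpha> by (simp add: continuous_at_imp_continuous_on)
  then have "mittag_leffler \<alpha> \<in> borel_measurable borel"
    by (rule borel_measurable_continuous_onI)
  then have k_meas [measurable]: "k \<in> borel_measurable borel"
    unfolding k_def by measurable
  have "continuous_on {0..b - a} k"
    unfolding k_def using \<alpha>
    by (intro continuous_on_compose2[OF mittag_leffler_cont _ subset_UNIV] continuous_on_mult continuous_on_powr'
        continuous_on_const continuous_on_id) auto
  then have "bounded (k ` {0..b - a})"
    by (intro compact_imp_bounded compact_continuous_image) auto
  then obtain M where M: "\<forall>r\<in>{0..b - a}. \<bar>k r\<bar> \<le> M"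
    by (auto simp: bounded_iff)
  note v = weak_deriv_H1[OF u(1)]
  obtain V where V: "integrable lborel V" "AE x in lborel. indicator {a<..<b} x * weak_deriv a b u x = V x"
    using L2_borel_version[OF v(1)] by blast
  have [measurable]: "V \<in> borel_measurable borel" using V(1) by auto
  define H where "H t = (LINT x:{a..t}|lborel. k (t - x) * V x)" for t
  have H_eq: "H t = (1 - \<alpha>) / B \<alpha> * G t" if t: "t \<in> {a<..b}" for t
  proof -
    have "(LINT x:{a..t}|lebesgue. k (t - x) * weak_deriv a b u x) = H t"
      unfolding H_def using t by (intro set_integral_borel_version[OF V v(1)]) auto
    then have "B \<alpha> / (1 - \<alpha>) * H t = G t"
      using bspec[OF eq t] by (simp add: ABC_deriv_def k_def \<kappa>_def)
    then show ?thesis using B \<alpha> by (auto simp: field_simps)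
  qed
  have V_set: "set_integrable lborel {c..d} (\<lambda>x. \<bar>V x\<bar>)" for c d
    using V(1) unfolding set_integrable_def by (intro integrable_mult_indicator) auto
  have kV: "set_integrable lborel {a..t} (\<lambda>x. k (t - x) * V x)" if t: "t \<in> {a..b}" for t
    unfolding set_integrable_def
  proof (rule Bochner_Integration.integrable_bound)
    show "integrable lborel (\<lambda>x. M * V x)" using V(1) by simp
    have "\<bar>k (t - x)\<bar> * \<bar>V x\<bar> \<le> \<bar>M\<bar> * \<bar>V x\<bar>" if "x \<in> {a..t}" for x
      using that t M[rule_format, of "t - x"] by (intro mult_right_mono) auto
    then show "AE x in lborel. norm (indicator {a..t} x *\<^sub>R (k (t - x) * V x)) \<le> norm (M * V x)"
      by (auto simp: indicator_def abs_mult)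
  qed simp
  have H_a: "H a = 0"
  proof -
    have "AE x in lborel. indicator {a..a} x *\<^sub>R (k (a - x) * V x) = 0"
      using AE_lborel_singleton[of a] by eventually_elim simp
    then show ?thesis
      unfolding H_def set_lebesgue_integral_def by (rule integral_eq_zero_AE)
  qed
  show G_a: "G a = 0"
  proof -
    \<comment> \<open>The derivative need not be bounded near a; continuity of the integral of |V|
      makes the bound \<open>M * N t\<close> tend to 0 instead.\<close>
    define N where "N t = integral {a..t} (\<lambda>x. \<bar>V x\<bar>)" for t
    have "continuous_on {a..b} N"
      unfolding N_def by (intro indefinite_integral_continuous_1 set_borel_integral_eq_integral(1) V_set)
    then have "(N \<longlongrightarrow> N a) (at a within {a..b})"
      using \<open>a < b\<close> by (simp add: continuous_on)
    then have "(N \<longlongrightarrow> 0) (at_right a)"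
      using \<open>a < b\<close> by (simp add: at_within_Icc_at_right N_def)
    then have lim0: "((\<lambda>t. M * N t) \<longlongrightarrow> 0) (at_right a)"
      by (rule tendsto_mult_right_zero)
    have bound: "\<bar>H t\<bar> \<le> M * N t" if t: "t \<in> {a<..b}" for t
    proof -
      have "\<bar>H t\<bar> \<le> (LINT x:{a..t}|lborel. M * \<bar>V x\<bar>)"
      proof -
        have "\<bar>k (t - x) * V x\<bar> \<le> M * \<bar>V x\<bar>" if "x \<in> {a..t}" for x
          unfolding abs_mult using that t M by (intro mult_right_mono) auto
        then have le: "norm (indicator {a..t} x *\<^sub>R (k (t - x) * V x)) \<le> indicator {a..t} x *\<^sub>R (M * \<bar>V x\<bar>)" for x
          by (auto simp: indicator_def)
        have "integrable lborel (\<lambda>x. indicator {a..t} x *\<^sub>R (M * \<bar>V x\<bar>))"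
          using integrable_mult_right[OF V_set[of a t, unfolded set_integrable_def], of M] by (simp add: mult_ac)
        then have "norm (LINT x|lborel. indicator {a..t} x *\<^sub>R (k (t - x) * V x))
            \<le> (LINT x|lborel. indicator {a..t} x *\<^sub>R (M * \<bar>V x\<bar>))"
          using le kV[of t] t by (intro Bochner_Integration.integral_norm_bound_integral) (auto simp: set_integrable_def)
        then show ?thesis
          by (simp only: H_def set_lebesgue_integral_def real_norm_def)
      qed
      also have "\<dots> = M * N t"
        using set_borel_integral_eq_integral(2)[OF V_set, of a t] by (simp add: N_def)
      finally show ?thesis .
    qed
    have ev: "\<forall>\<^sub>F t in at_right a. t \<in> {a<..b}"
      using \<open>a < b\<close> by (auto simp: eventually_at_right_field intro!: exI[of _ b])
    have "((\<lambda>t. (1 - \<alpha>) / B \<alpha> * G t) \<longlongrightarrow> 0) (at_right a)"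
      by (rule Lim_null_comparison[OF _ lim0], rule eventually_mono[OF ev])
        (use bound H_eq in force)
    moreover have "((\<lambda>t. (1 - \<alpha>) / B \<alpha> * G t) \<longlongrightarrow> (1 - \<alpha>) / B \<alpha> * G a) (at_right a)"
    proof -
      have "(G \<longlongrightarrow> G a) (at a within {a..b})"
        using G \<open>a < b\<close> by (simp add: continuous_on)
      then show ?thesis
        using \<open>a < b\<close> by (intro tendsto_mult_left) (simp add: at_within_Icc_at_right)
    qed
    ultimately have "(1 - \<alpha>) / B \<alpha> * G a = 0"
      using tendsto_unique[OF trivial_limit_at_right_real] by blast
    then show ?thesis using B \<alpha> by simp
  qed
  fix t assume t: "t \<in> {a..b}"
  define R where "R r = Gamma \<alpha> / \<kappa> * (k r - 1)" for r
  have "(LINT s:{0..r}|lborel. (r - s) powr (\<alpha> - 1) * k s) = R r" if "r \<ge> 0" for r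
    unfolding k_def R_def using \<alpha> \<kappa> that by (intro mittag_leffler_resolvent) auto
  note conv = abel_integral_convolution[where a = a and t = t and M = M and R = R, OF \<alpha>(1) _ V(1) k_meas _ this]
  have V_set': "set_integrable lborel {a..t} V"
    using V(1) unfolding set_integrable_def by (intro integrable_mult_indicator) auto
  \<comment> \<open>The summand -1 in \<open>R\<close> leaves the plain integral of
    \<open>V\<close>, which is where u t - u a enters.\<close>
  have "(LINT x:{a..t}|lborel. R (t - x) * V x) = (LINT x:{a..t}|lborel. Gamma \<alpha> / \<kappa> * (k (t - x) * V x - V x))"
    by (simp add: R_def algebra_simps)
  also have "\<dots> = Gamma \<alpha> / \<kappa> * (H t - (LINT x:{a..t}|lborel. V x))"
    using set_integral_diff(2)[OF kV[OF t] V_set'] by (simp add: H_def)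
  also have "(LINT x:{a..t}|lborel. V x) = u t - u a"
    using weak_derivative_integral[OF \<open>a < b\<close> t u(2) v(2,1) V] by simp
  finally have R_int: "(LINT x:{a..t}|lborel. R (t - x) * V x) = Gamma \<alpha> / \<kappa> * (H t - (u t - u a))" .
  \<comment> \<open>At s = a both sides are 0, so the relation holds on the whole closed
    interval.\<close>
  have H_eq': "H s = (1 - \<alpha>) / B \<alpha> * G s" if "s \<in> {a..b}" for s
    using H_eq[of s] H_a G_a that by (cases "s = a") auto
  have "(LINT s:{a..t}|lborel. (t - s) powr (\<alpha> - 1) * H s) = integral {a..t} (\<lambda>s. (t - s) powr (\<alpha> - 1) * H s)"
    using conv(1) t M unfolding H_def by (intro set_borel_integral_eq_integral(2)) auto
  also have "\<dots> = integral {a..t} (\<lambda>s. (1 - \<alpha>) / B \<alpha> * ((t - s) powr (\<alpha> - 1) * G s))"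
    using t by (intro integral_cong) (simp add: H_eq')
  also have "\<dots> = (1 - \<alpha>) / B \<alpha> * integral {a..t} (\<lambda>s. (t - s) powr (\<alpha> - 1) * G s)"
    by (rule integral_mult_right)
  finally have "(1 - \<alpha>) / B \<alpha> * integral {a..t} (\<lambda>s. (t - s) powr (\<alpha> - 1) * G s) = Gamma \<alpha> / \<kappa> * (H t - (u t - u a))"
    using conv(2) t M R_int by (simp add: H_def)
  then have "u t - u a = H t - \<kappa> / Gamma \<alpha> * ((1 - \<alpha>) / B \<alpha> * integral {a..t} (\<lambda>s. (t - s) powr (\<alpha> - 1) * G s))"
    using \<kappa> Gamma_real_pos[OF \<alpha>(1)] by simp
  moreover have "\<kappa> / Gamma \<alpha> * ((1 - \<alpha>) / B \<alpha> * I) = - (\<alpha> / (B \<alpha> * Gamma \<alpha>) * I)" for I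
  proof -
    have "\<kappa> / Gamma \<alpha> * ((1 - \<alpha>) / B \<alpha> * I) = (\<kappa> * (1 - \<alpha>)) / (B \<alpha> * Gamma \<alpha>) * I"
      by (simp add: mult_ac)
    also have "\<kappa> * (1 - \<alpha>) = - \<alpha>"
      using \<alpha> by (simp add: \<kappa>_def)
    finally show ?thesis by simp
  qed
  ultimately show "u t - u a = (1 - \<alpha>) / B \<alpha> * G t
      + \<alpha> / (B \<alpha> * Gamma \<alpha>) * integral {a..t} (\<lambda>s. (t - s) powr (\<alpha> - 1) * G s)"
    using H_eq'[OF t] by simp
qed

section \<open>Comparison of two solutions with ordered right-hand sides\<close>

theorem corollary3p1:
  fixes a b \<alpha> :: real and B p g1 g2 u1 u2 :: "real \<Rightarrow> real"
  assumes "a < b" and "0 < \<alpha>" and "\<alpha> < 1"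
    and "normalization_function B"
    and "continuous_on {a..b} p" and "continuous_on {a..b} g1" and "continuous_on {a..b} g2"
    and "\<forall>t\<in>{a..b}. p t \<ge> 0" and "p a \<noteq> 0"
    and "u1 \<in> H1 a b" and "continuous_on {a..b} u1"
    and "u2 \<in> H1 a b" and "continuous_on {a..b} u2"
    and "\<forall>t\<in>{a<..b}. ABC_deriv B \<alpha> a b u1 t + p t * u1 t = g1 t"
    and "\<forall>t\<in>{a<..b}. ABC_deriv B \<alpha> a b u2 t + p t * u2 t = g2 t"
    and "\<forall>t\<in>{a..b}. g1 t \<le> g2 t"
  shows "\<forall>t\<in>{a..b}. u1 t \<le> u2 t"
proof
  fix t assume t: "t \<in> {a..b}"
  have B: "B \<alpha> > 0"
    using assms(2-4) by (simp add: normalization_function_def)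
  define G where "G g u t = g t - p t * u t" for g u :: "real \<Rightarrow> real" and t
  have G_cont: "continuous_on {a..b} (G g1 u1)" "continuous_on {a..b} (G g2 u2)"
    unfolding G_def using assms by (auto intro!: continuous_intros)
  have eqs: "\<forall>t\<in>{a<..b}. ABC_deriv B \<alpha> a b u1 t = G g1 u1 t"
    "\<forall>t\<in>{a<..b}. ABC_deriv B \<alpha> a b u2 t = G g2 u2 t"
    using assms(14,15) by (auto simp: G_def algebra_simps)
  note vol1 = ABC_deriv_Volterra[OF assms(1-3) B assms(10,11) G_cont(1) eqs(1)]
  note vol2 = ABC_deriv_Volterra[OF assms(1-3) B assms(12,13) G_cont(2) eqs(2)]
  define w where "w t = u2 t - u1 t" for t
  define g where "g t = g2 t - g1 t" for t
  define F where "F t = g t - p t * w t" for t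
  have F_eq: "F t = G g2 u2 t - G g1 u1 t" for t
    by (simp add: F_def G_def g_def w_def algebra_simps)
  have F_cont: "continuous_on {a..b} F" and w_cont: "continuous_on {a..b} w"
    unfolding F_eq[abs_def] w_def using G_cont assms by (auto intro!: continuous_intros)
  have g: "g t \<ge> 0" if "t \<in> {a..b}" for t
    using assms(16) that by (simp add: g_def)
  have F_nonneg: "F t \<ge> 0" if "t \<in> {a..b}" "w t \<le> 0" for t
    using g[OF that(1)] mult_nonneg_nonpos[of "p t" "w t"] assms(8) that by (simp add: F_def)
  \<comment> \<open>Both Volterra equations force their right-hand sides to vanish at a, so F a = 0,
    that is, p(a) w(a) = g(a) \<ge> 0; division by p(a) > 0 gives the sign.\<close>
  have w_a: "w a \<ge> 0"
  proof -
    have "p a > 0" using assms(1,8,9) by (simp add: order_less_le)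
    moreover have "p a * w a \<ge> 0"
      using vol1(1) vol2(1) F_eq[of a] g[of a] assms(1) by (simp add: F_def)
    ultimately show ?thesis by (simp add: zero_le_mult_iff)
  qed
  \<comment> \<open>The coefficients of the Volterra equation: with \<lambda> = \<alpha>/(1 -
    \<alpha>), \<mu> equals \<lambda> c / Gamma(\<alpha>), the Gamma factor being the normalization
    of I^\<alpha>. Subtracting the local term c F from w leaves w(a) plus an Abel integral, the form
    required by \<open>abel_comparison\<close>.\<close>
  define c where "c = (1 - \<alpha>) / B \<alpha>"
  define \<mu> where "\<mu> = \<alpha> / (B \<alpha> * Gamma \<alpha>)"
  have c: "c > 0" and \<mu>: "\<mu> > 0"
    using assms(2,3) B by (auto simp: c_def \<mu>_def)
  define y where "y t = w t - c * F t" for t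
  have y_nonneg: "y t \<ge> 0"
  proof (rule abel_comparison[where h = "\<lambda>s. \<mu> * F s" and y = y, OF assms(2,3) _ _ _ w_a _ t])
    show "continuous_on {a..b} (\<lambda>s. \<mu> * F s)" "continuous_on {a..b} y"
      unfolding y_def by (intro continuous_intros F_cont w_cont)+
    fix t assume t: "t \<in> {a..b}"
    have int: "(\<lambda>s. (t - s) powr (\<alpha> - 1) * h s) integrable_on {a..t}" if "continuous_on {a..b} h" for h
      using t assms(2) that
      by (intro set_lebesgue_integral_eq_integral(1) abel_integrable continuous_on_subset[OF that]) auto
    have "integral {a..t} (\<lambda>s. (t - s) powr (\<alpha> - 1) * (\<mu> * F s))
        = integral {a..t} (\<lambda>s. \<mu> * ((t - s) powr (\<alpha> - 1) * G g2 u2 s - (t - s) powr (\<alpha> - 1) * G g1 u1 s))"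
      by (simp add: F_eq algebra_simps)
    also have "\<dots> = \<mu> * (integral {a..t} (\<lambda>s. (t - s) powr (\<alpha> - 1) * G g2 u2 s)
        - integral {a..t} (\<lambda>s. (t - s) powr (\<alpha> - 1) * G g1 u1 s))"
      by (subst integral_mult_right, subst integral_diff) (auto intro: int G_cont)
    finally show "y t = w a + integral {a..t} (\<lambda>s. (t - s) powr (\<alpha> - 1) * (\<mu> * F s))"
      using vol1(2)[OF t] vol2(2)[OF t]
      by (simp add: y_def w_def F_eq algebra_simps flip: c_def \<mu>_def)
    show "\<mu> * F t \<ge> 0" if "y t < 0"
    proof (cases "w t \<le> 0")
      case True
      then show ?thesis using F_nonneg[OF t] \<mu> by simp
    next
      case False
      then have "c * F t > 0" using that by (simp add: y_def)
      then show ?thesis using c \<mu> by (simp add: zero_less_mult_iff)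
    qed
  qed
  have "w t \<ge> 0"
  proof (rule ccontr)
    assume "\<not> w t \<ge> 0"
    moreover from this have "c * F t \<ge> 0" using F_nonneg[OF t] c by simp
    ultimately show False using y_nonneg by (simp add: y_def)
  qed
  then show "u1 t \<le> u2 t" by (simp add: w_def)
qed

end
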